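(* Let $\mathcal K$ be an oriented chiral $d$-polytope with directly regular facets, and suppose the automorphism group of $\mathcal K$ is a finite 2-group or an infinite 2-group. Then the free extension $\mathcal P$ of $\mathcal K$ is an oriented chiral $(d+1)$-polytope whose automorphism group is an infinite 2-group.
   Context: **Infinite 2-groups.** A finitely generated infinite group $G$ is called an infinite 2-group if every element of $G$ of finite order has 2-power order. **Polytopes.** An (abstract) polytope of rank $d$ (a $d$-polytope) is a partially ordered set $\mathcal P$ with a strictly monotone rank function with values in $\{-1,0,\ldots,d\}$, having a unique least face $F_{-1}$ (rank $-1$) and a unique greatest face $F_d$ (rank $d$), such that: every flag (maximal totally ordered subset) has exactly $d+2$ faces, one of each rank; $\mathcal P$ is strongly flag-connected (any two flags $\Phi,\Psi$ are joined by a finite sequence of flags, each containing $\Phi\cap\Psi$, in which successive flags are adjacent, i.e. differ in exactly one face); and the diamond condition holds (if $F\le G$ have ranks $j-1$ and $j+1$, there are exactly two $j$-faces $H$ with $F\le H\le G$). Facets are the $(d-1)$-faces; a facet $F$ is identified with the section $F/F_{-1}=\{H: F_{-1}\le H\le F\}$. $\Phi^j$ denotes the unique flag differing from the flag $\Phi$ exactly in its $j$-face. **Regular and directly regular.** $\mathcal P$ is regular if its automorphism group $\Gamma(\mathcal P)$ is transitive on flags; then $\Gamma(\mathcal P)=\langle\rho_0,\ldots,\rho_{d-1}\rangle$, where the involution $\rho_i$ maps a fixed base flag $\Phi$ to $\Phi^i$. Its rotation subgroup $\Gamma^+(\mathcal P)=\langle\sigma_1,\ldots,\sigma_{d-1}\rangle$,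 $\sigma_i=\rho_{i-1}\rho_i$, has index at most 2, and $\mathcal P$ is directly regular if the index is 2. **Chiral.** $\mathcal P$ is chiral if $\Gamma(\mathcal P)$ has exactly two flag orbits and any two adjacent flags lie in distinct orbits. Then $\Gamma(\mathcal P)$ is generated by $\sigma_1,\ldots,\sigma_{d-1}$, where $\sigma_i$ maps a fixed base flag $\Phi$ to $(\Phi^i)^{i-1}$. The two flag orbits (represented by $\Phi$ and $\Phi^0$) give two non-conjugate sets of distinguished generators (the two enantiomorphic forms). An oriented chiral polytope is a chiral polytope together with one of these two sets of distinguished generators. **Free extension.** A chiral extension of an oriented chiral $d$-polytope $\mathcal K$ is an oriented chiral $(d+1)$-polytope with (oriented) facets isomorphic to $\mathcal K$. It is known that, if the facets $\mathcal F$ of $\mathcal K$ are directly regular, there is a chiral extension $\mathcal P$ of $\mathcal K$, called the free extension of $\mathcal K$, that covers every chiral extension of $\mathcal K$. Its group is the amalgamated free product $$\Gamma(\mathcal P)=\Gamma(\mathcal K)\ast_{\Gamma^+(\mathcal F)}\Gamma(\mathcal F)=\Gamma(\mathcal K)\ast_{\Gamma^+(\mathcal F)}(\Gamma^+(\mathcal F)\rtimes C_2),$$ where $\Gamma^+(\mathcal F)$ is identified with the subgroup $\langle\sigma_1,\ldots,\sigma_{d-2}\rangle$ of $\Gamma(\mathcal K)=\langle\sigma_1,\ldots,\sigma_{d-1}\rangle$ and with the rotation subgroup (of index 2) of $\Gamma(\mathcal F)$. *)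

theory Defs
  imports "HOL-Algebra.Algebra"
begin

section \<open>Finitely generated groups and 2-groups\<close>

definition finitely_generated :: "('g, 'm) monoid_scheme \<Rightarrow> bool" where
  "finitely_generated G \<longleftrightarrow>
     (\<exists>S. finite S \<and> S \<subseteq> carrier G \<and> generate G S = carrier G)"

definition finite_2_group :: "('g, 'm) monoid_scheme \<Rightarrow> bool" where
  "finite_2_group G \<longleftrightarrow> group G \<and> finite (carrier G) \<and> (\<exists>k. order G = 2 ^ k)"

text \<open>In HOL-Algebra, \<open>group.ord G x = 0\<close> means that \<open>x\<close> has infinite order.\<close>

definition infinite_2_group :: "('g, 'm) monoid_scheme \<Rightarrow> bool" where
  "infinite_2_group G \<longleftrightarrow> group G \<and> finitely_generated G \<and> infinite (carrier G) \<and>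
     (\<forall>x\<in>carrier G. group.ord G x \<noteq> 0 \<longrightarrow> (\<exists>k. group.ord G x = 2 ^ k))"


section \<open>Amalgamated free products\<close>

text \<open>
  The free product of \<open>G\<close> and \<open>H\<close> in which every element \<open>c\<close> of the subgroup \<open>C\<close> of \<open>G\<close> is
  identified with the element \<open>\<phi> c\<close> of \<open>H\<close> (\<open>\<phi>\<close> is meant to be an injective homomorphism
  \<open>C \<rightarrow> H\<close>): words in the elements of \<open>G\<close> and of \<open>H\<close> modulo the congruence generated by the
  relations of \<open>G\<close>, the relations of \<open>H\<close>, and the identifications \<open>c = \<phi> c\<close>.
\<close>

definition amalgam_words ::
    "('g, 'm) monoid_scheme \<Rightarrow> ('h, 'n) monoid_scheme \<Rightarrow> ('g + 'h) list set" where
  "amalgam_words G H = lists (carrier G <+> carrier H)"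

inductive_set amalgam_cong ::
    "('g, 'm) monoid_scheme \<Rightarrow> ('h, 'n) monoid_scheme \<Rightarrow> 'g set \<Rightarrow> ('g \<Rightarrow> 'h)
      \<Rightarrow> (('g + 'h) list \<times> ('g + 'h) list) set"
  for G :: "('g, 'm) monoid_scheme" and H :: "('h, 'n) monoid_scheme"
    and C :: "'g set" and \<phi> :: "'g \<Rightarrow> 'h" where
  refl: "w \<in> amalgam_words G H \<Longrightarrow> (w, w) \<in> amalgam_cong G H C \<phi>"
| sym: "(u, v) \<in> amalgam_cong G H C \<phi> \<Longrightarrow> (v, u) \<in> amalgam_cong G H C \<phi>"
| trans: "(u, v) \<in> amalgam_cong G H C \<phi> \<Longrightarrow> (v, w) \<in> amalgam_cong G H C \<phi>
    \<Longrightarrow> (u, w) \<in> amalgam_cong G H C \<phi>"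
| append: "(u, u') \<in> amalgam_cong G H C \<phi> \<Longrightarrow> (v, v') \<in> amalgam_cong G H C \<phi>
    \<Longrightarrow> (u @ v, u' @ v') \<in> amalgam_cong G H C \<phi>"
| one_left: "([Inl \<one>\<^bsub>G\<^esub>], []) \<in> amalgam_cong G H C \<phi>"
| one_right: "([Inr \<one>\<^bsub>H\<^esub>], []) \<in> amalgam_cong G H C \<phi>"
| mult_left: "x \<in> carrier G \<Longrightarrow> y \<in> carrier G
    \<Longrightarrow> ([Inl x, Inl y], [Inl (x \<otimes>\<^bsub>G\<^esub> y)]) \<in> amalgam_cong G H C \<phi>"
| mult_right: "x \<in> carrier H \<Longrightarrow> y \<in> carrier H
    \<Longrightarrow> ([Inr x, Inr y], [Inr (x \<otimes>\<^bsub>H\<^esub> y)]) \<in> amalgam_cong G H C \<phi>"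
| amalgamate: "c \<in> C \<Longrightarrow> ([Inl c], [Inr (\<phi> c)]) \<in> amalgam_cong G H C \<phi>"

definition amalgamated_product ::
    "('g, 'm) monoid_scheme \<Rightarrow> ('h, 'n) monoid_scheme \<Rightarrow> 'g set \<Rightarrow> ('g \<Rightarrow> 'h)
      \<Rightarrow> ('g + 'h) list set monoid" where
  "amalgamated_product G H C \<phi> =
     \<lparr>carrier = amalgam_words G H // amalgam_cong G H C \<phi>,
      monoid.mult = (\<lambda>A B. \<Union>u\<in>A. \<Union>v\<in>B. amalgam_cong G H C \<phi> `` {u @ v}),
      one = amalgam_cong G H C \<phi> `` {[]}\<rparr>"


section \<open>Abstract polytopes\<close>

record 'a ranked_poset =
  below :: "'a rel"
  rk :: "'a \<Rightarrow> int"

definition faces :: "'a ranked_poset \<Rightarrow> 'a set" where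
  "faces P = Field (below P)"

definition flags :: "'a ranked_poset \<Rightarrow> 'a set set" where
  "flags P = {\<Phi> \<in> Chains (below P). \<forall>C \<in> Chains (below P). \<Phi> \<subseteq> C \<longrightarrow> C = \<Phi>}"

definition adjacent :: "'a set \<Rightarrow> 'a set \<Rightarrow> bool" where
  "adjacent \<Phi> \<Psi> \<longleftrightarrow> card (\<Phi> - \<Psi>) = 1 \<and> card (\<Psi> - \<Phi>) = 1"

definition strongly_flag_connected :: "'a ranked_poset \<Rightarrow> bool" where
  "strongly_flag_connected P \<longleftrightarrow> (\<forall>\<Phi>\<in>flags P. \<forall>\<Psi>\<in>flags P.
     (\<Phi>, \<Psi>) \<in> {(\<Lambda>, \<Lambda>'). \<Lambda> \<in> flags P \<and> \<Lambda>' \<in> flags P \<and> adjacent \<Lambda> \<Lambda>' \<and>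
                        \<Phi> \<inter> \<Psi> \<subseteq> \<Lambda> \<and> \<Phi> \<inter> \<Psi> \<subseteq> \<Lambda>'}\<^sup>*)"

definition diamond_condition :: "'a ranked_poset \<Rightarrow> bool" where
  "diamond_condition P \<longleftrightarrow> (\<forall>F G. (F, G) \<in> below P \<and> rk P G = rk P F + 2 \<longrightarrow>
     card {H \<in> faces P. rk P H = rk P F + 1 \<and> (F, H) \<in> below P \<and> (H, G) \<in> below P} = 2)"

text \<open>Uniqueness of the least and of the greatest face follows from antisymmetry.\<close>

definition abstract_polytope :: "nat \<Rightarrow> 'a ranked_poset \<Rightarrow> bool" where
  "abstract_polytope d P \<longleftrightarrow>
     Partial_order (below P) \<and>
     rk P ` faces P \<subseteq> {-1..int d} \<and>
     (\<forall>F G. (F, G) \<in> below P \<and> F \<noteq> G \<longrightarrow> rk P F < rk P G) \<and>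
     (\<exists>F\<in>faces P. rk P F = -1 \<and> (\<forall>G\<in>faces P. (F, G) \<in> below P)) \<and>
     (\<exists>F\<in>faces P. rk P F = int d \<and> (\<forall>G\<in>faces P. (G, F) \<in> below P)) \<and>
     (\<forall>\<Phi>\<in>flags P. bij_betw (rk P) \<Phi> {-1..int d}) \<and>
     strongly_flag_connected P \<and>
     diamond_condition P"

text \<open>The section \<open>F / F\<^sub>-\<^sub>1\<close>.\<close>

definition lower_section :: "'a ranked_poset \<Rightarrow> 'a \<Rightarrow> 'a ranked_poset" where
  "lower_section P F = P\<lparr>below := Restr (below P) {H. (H, F) \<in> below P}\<rparr>"

text \<open>The flag \<open>\<Phi>\<^sup>j\<close>.\<close>

definition flag_change :: "'a ranked_poset \<Rightarrow> 'a set \<Rightarrow> nat \<Rightarrow> 'a set" where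
  "flag_change P \<Phi> j = (THE \<Psi>. \<Psi> \<in> flags P \<and> \<Psi> \<noteq> \<Phi> \<and>
     {F \<in> \<Psi>. rk P F \<noteq> int j} = {F \<in> \<Phi>. rk P F \<noteq> int j})"

definition flag_face :: "'a ranked_poset \<Rightarrow> 'a set \<Rightarrow> int \<Rightarrow> 'a" where
  "flag_face P \<Phi> j = (THE F. F \<in> \<Phi> \<and> rk P F = j)"

definition flag_below :: "'a ranked_poset \<Rightarrow> 'a set \<Rightarrow> 'a \<Rightarrow> 'a set" where
  "flag_below P \<Phi> F = {H \<in> \<Phi>. (H, F) \<in> below P}"


section \<open>Isomorphisms and automorphism groups\<close>

text \<open>An isomorphism of posets between polytopes of the same rank preserves ranks.\<close>

definition poset_isos :: "'a ranked_poset \<Rightarrow> 'b ranked_poset \<Rightarrow> ('a \<Rightarrow> 'b) set" where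
  "poset_isos P Q = {g. bij_betw g (faces P) (faces Q) \<and>
     (\<forall>F\<in>faces P. \<forall>G\<in>faces P. (g F, g G) \<in> below Q \<longleftrightarrow> (F, G) \<in> below P)}"

text \<open>
  Automorphisms act on the right: \<open>f \<otimes> g\<close> is \<open>f\<close> followed by \<open>g\<close>. This is the convention
  for which \<open>\<rho>\<^sub>i\<^sub>-\<^sub>1 \<rho>\<^sub>i\<close> maps the base flag \<open>\<Phi>\<close> to \<open>(\<Phi>\<^sup>i)\<^sup>i\<^sup>-\<^sup>1\<close>.
\<close>

definition Aut :: "'a ranked_poset \<Rightarrow> ('a \<Rightarrow> 'a) monoid" where
  "Aut P = \<lparr>carrier = Bij (faces P) \<inter> poset_isos P P,
            monoid.mult = (\<lambda>f g. compose (faces P) g f),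
            one = (\<lambda>F\<in>faces P. F)\<rparr>"

definition flag_orbit :: "'a ranked_poset \<Rightarrow> 'a set \<Rightarrow> 'a set set" where
  "flag_orbit P \<Phi> = {f ` \<Phi> | f. f \<in> carrier (Aut P)}"


section \<open>Regular polytopes\<close>

definition regular :: "nat \<Rightarrow> 'a ranked_poset \<Rightarrow> bool" where
  "regular d P \<longleftrightarrow> abstract_polytope d P \<and>
     (\<forall>\<Phi>\<in>flags P. \<forall>\<Psi>\<in>flags P. \<exists>f\<in>carrier (Aut P). f ` \<Phi> = \<Psi>)"

text \<open>The generators \<open>\<rho>\<^sub>i\<close> with respect to the base flag \<open>\<Phi>\<close>.\<close>

definition reflection :: "'a ranked_poset \<Rightarrow> 'a set \<Rightarrow> nat \<Rightarrow> ('a \<Rightarrow> 'a)" where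
  "reflection P \<Phi> i = (THE f. f \<in> carrier (Aut P) \<and> f ` \<Phi> = flag_change P \<Phi> i)"

definition rotation_subgroup :: "nat \<Rightarrow> 'a ranked_poset \<Rightarrow> 'a set \<Rightarrow> ('a \<Rightarrow> 'a) set" where
  "rotation_subgroup d P \<Phi> = generate (Aut P)
     {reflection P \<Phi> (i - 1) \<otimes>\<^bsub>Aut P\<^esub> reflection P \<Phi> i | i. 1 \<le> i \<and> i < d}"

text \<open>The index of the rotation subgroup does not depend on the base flag.\<close>

definition directly_regular :: "nat \<Rightarrow> 'a ranked_poset \<Rightarrow> bool" where
  "directly_regular d P \<longleftrightarrow> regular d P \<and>
     (\<forall>\<Phi>\<in>flags P. card (rcosets\<^bsub>Aut P\<^esub> (rotation_subgroup d P \<Phi>)) = 2)"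


section \<open>Oriented chiral polytopes\<close>

definition chiral :: "nat \<Rightarrow> 'a ranked_poset \<Rightarrow> bool" where
  "chiral d P \<longleftrightarrow> abstract_polytope d P \<and>
     card (flag_orbit P ` flags P) = 2 \<and>
     (\<forall>\<Phi>\<in>flags P. \<forall>\<Psi>\<in>flags P. adjacent \<Phi> \<Psi> \<longrightarrow> flag_orbit P \<Phi> \<noteq> flag_orbit P \<Psi>)"

text \<open>The distinguished generators \<open>\<sigma>\<^sub>i\<close> with respect to the base flag \<open>\<Phi>\<close>.\<close>

definition chiral_rotation :: "'a ranked_poset \<Rightarrow> 'a set \<Rightarrow> nat \<Rightarrow> ('a \<Rightarrow> 'a)" where
  "chiral_rotation P \<Phi> i = (THE f. f \<in> carrier (Aut P) \<and>
     f ` \<Phi> = flag_change P (flag_change P \<Phi> i) (i - 1))"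

text \<open>
  An orientation is recorded by a base flag, which determines the distinguished generators
  \<open>chiral_rotation P \<Phi> i\<close>. Flags in the same orbit yield conjugate generators, hence the same
  orientation; the two flag orbits are the two enantiomorphic forms. Accordingly, an isomorphism
  of oriented polytopes maps the base flag into the orbit of the base flag.
\<close>

definition oriented_chiral :: "nat \<Rightarrow> 'a ranked_poset \<Rightarrow> 'a set \<Rightarrow> bool" where
  "oriented_chiral d P \<Phi> \<longleftrightarrow> chiral d P \<and> \<Phi> \<in> flags P"

definition oriented_iso ::
    "'a ranked_poset \<Rightarrow> 'a set \<Rightarrow> 'b ranked_poset \<Rightarrow> 'b set \<Rightarrow> bool" where
  "oriented_iso P \<Phi> Q \<Psi> \<longleftrightarrow> (\<exists>g\<in>poset_isos P Q. g ` \<Phi> \<in> flag_orbit Q \<Psi>)"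

definition has_directly_regular_facets :: "nat \<Rightarrow> 'a ranked_poset \<Rightarrow> bool" where
  "has_directly_regular_facets d P \<longleftrightarrow>
     (\<forall>F\<in>faces P. rk P F = int d - 1 \<longrightarrow> directly_regular (d - 1) (lower_section P F))"


section \<open>Chiral extensions and the free extension\<close>

text \<open>
  Every facet of \<open>P\<close> lies in some flag of the chosen orbit and is oriented by such flags.
\<close>

definition chiral_extension ::
    "nat \<Rightarrow> 'a ranked_poset \<Rightarrow> 'a set \<Rightarrow> 'b ranked_poset \<Rightarrow> 'b set \<Rightarrow> bool" where
  "chiral_extension d K \<Phi> P \<Psi> \<longleftrightarrow> oriented_chiral (d + 1) P \<Psi> \<and>
     (\<forall>\<Lambda>\<in>flag_orbit P \<Psi>. let F = flag_face P \<Lambda> (int d) in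
        oriented_iso (lower_section P F) (flag_below P \<Lambda> F) K \<Phi>)"

text \<open>
  Coverings are, as usual for abstract polytopes, surjections that preserve incidence, rank and
  adjacency of flags; here they also preserve the orientation.
\<close>

definition oriented_covers ::
    "'a ranked_poset \<Rightarrow> 'a set \<Rightarrow> 'b ranked_poset \<Rightarrow> 'b set \<Rightarrow> bool" where
  "oriented_covers P \<Psi> Q \<Lambda> \<longleftrightarrow> (\<exists>\<gamma>.
     \<gamma> ` faces P = faces Q \<and>
     (\<forall>F G. (F, G) \<in> below P \<longrightarrow> (\<gamma> F, \<gamma> G) \<in> below Q) \<and>
     (\<forall>F\<in>faces P. rk Q (\<gamma> F) = rk P F) \<and>
     (\<forall>\<Phi>\<in>flags P. \<forall>\<Phi>'\<in>flags P. adjacent \<Phi> \<Phi>' \<longrightarrow> adjacent (\<gamma> ` \<Phi>) (\<gamma> ` \<Phi>')) \<and>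
     \<gamma> ` \<Psi> \<in> flag_orbit Q \<Lambda>)"

text \<open>
  The group \<open>\<Gamma>(K) *\<^bsub>\<Gamma>\<^sup>+(F)\<^esub> \<Gamma>(F)\<close>, with \<open>F\<close> the base facet of \<open>K\<close>. The subgroup
  \<open>\<langle>\<sigma>\<^sub>1, \<dots>, \<sigma>\<^sub>d\<^sub>-\<^sub>2\<rangle>\<close> of \<open>\<Gamma>(K)\<close> stabilises \<open>F\<close>; restricting its elements to the faces of \<open>F\<close>
  identifies it with the rotation subgroup of \<open>\<Gamma>(F)\<close>, sending \<open>\<sigma>\<^sub>i\<close> to \<open>\<rho>\<^sub>i\<^sub>-\<^sub>1 \<rho>\<^sub>i\<close>.
\<close>

definition free_extension_group ::
    "nat \<Rightarrow> 'a ranked_poset \<Rightarrow> 'a set \<Rightarrow> (('a \<Rightarrow> 'a) + ('a \<Rightarrow> 'a)) list set monoid" where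
  "free_extension_group d K \<Phi> = (let F = lower_section K (flag_face K \<Phi> (int d - 1)) in
     amalgamated_product (Aut K) (Aut F)
       (generate (Aut K) {chiral_rotation K \<Phi> i | i. 1 \<le> i \<and> i < d - 1})
       (\<lambda>f. restrict f (faces F)))"

text \<open>
  Strong flag-connectedness makes every polytope of finite rank countable, so polytopes whose
  faces are natural numbers represent all chiral extensions up to isomorphism.
\<close>

definition free_extension ::
    "nat \<Rightarrow> 'a ranked_poset \<Rightarrow> 'a set \<Rightarrow> 'b ranked_poset \<Rightarrow> 'b set \<Rightarrow> bool" where
  "free_extension d K \<Phi> P \<Psi> \<longleftrightarrow>
     chiral_extension d K \<Phi> P \<Psi> \<and>
     (\<forall>(Q :: nat ranked_poset) \<Lambda>. chiral_extension d K \<Phi> Q \<Lambda> \<longrightarrow> oriented_covers P \<Psi> Q \<Lambda>) \<and>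
     Aut P \<cong> free_extension_group d K \<Phi>"

end

theory Submission
  imports Defs
begin

text \<open>
  Write \<open>\<Gamma>(K)\<close> for the group of \<open>K\<close>, \<open>F\<close> for the base facet, and \<open>C = \<langle>\<sigma>\<^sub>1, \<dots>, \<sigma>\<^sub>d\<^sub>-\<^sub>2\<rangle>\<close>. The free
  extension is a chiral extension by definition, so the statement is one about the group
  \<open>\<Gamma>(P) = \<Gamma>(K) *\<^bsub>C\<^esub> \<Gamma>(F)\<close>, and it follows from the structure of amalgamated free products once the
  two factors and the amalgamated subgroup are understood.

  \<^emph>\<open>Torsion.\<close> In an amalgamated product every element of finite order is conjugate to an element
  of a factor (\<open>torsion_conjugate_letter\<close>). For the proof, take a shortest word representing a
  conjugate of the given element. If it had two or more letters, then minimality would force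
  cyclically adjacent letters to come from different factors and no letter to be amalgamated; all
  powers of such a word are reduced, hence nontrivial. That nonempty reduced words are nontrivial
  (\<open>reduced_nontrivial\<close>), and that the factors embed, is seen from van der Waerden's action of the
  product on normal forms. Torsion in \<open>\<Gamma>(K)\<close> has 2-power order by hypothesis. The group \<open>\<Gamma>(F)\<close>
  contains a copy of \<open>C\<close> with index two, so the square of each of its elements lies in \<open>C\<close> and its
  torsion has 2-power order as well.

  \<^emph>\<open>Infinity.\<close> If both inclusions of the amalgamated subgroup are proper, a product of two letters
  outside it has infinite order. In \<open>\<Gamma>(F)\<close> the inclusion has index two. In \<open>\<Gamma>(K)\<close> it is proper
  because \<open>C\<close> fixes \<open>F\<close>, while \<open>\<sigma>\<^sub>d\<^sub>-\<^sub>1\<close> moves it (\<open>stabiliser_proper\<close>).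

  \<^emph>\<open>Generation.\<close> Generators of the factors generate the product, and \<open>\<Gamma>(F)\<close> is generated by the
  finitely many generators of its rotation subgroup and one further element.

  The geometric input is that restriction to \<open>F\<close> maps \<open>C\<close> isomorphically onto the rotation subgroup
  of \<open>\<Gamma>(F)\<close>. Everything here rests on the fact that an automorphism is determined by its effect on
  one flag (\<open>aut_eqI\<close>), a consequence of the diamond condition and flag-connectedness: it makes the
  generators \<open>\<sigma>\<^sub>i\<close> and \<open>\<rho>\<^sub>i\<close> well defined, identifies the restriction of \<open>\<sigma>\<^sub>i\<close> with \<open>\<rho>\<^sub>i\<^sub>-\<^sub>1 \<rho>\<^sub>i\<close>
  (\<open>chiral_rotation_facet\<close>), and shows that restriction is injective (\<open>restrict_inj\<close>).
\<close>

section \<open>2-power torsion\<close>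

text \<open>
  Finite order is expressed by an equation \<open>x\<^sup>n = 1\<close> with \<open>n > 0\<close>, rather than through \<open>ord\<close>, since
  such equations are directly transported along injective homomorphisms and conjugations.
\<close>

definition torsion_2_power :: "('g, 'm) monoid_scheme \<Rightarrow> bool" where
  "torsion_2_power G \<longleftrightarrow>
     (\<forall>x\<in>carrier G. \<forall>n::nat. 0 < n \<longrightarrow> x [^]\<^bsub>G\<^esub> n = \<one>\<^bsub>G\<^esub> \<longrightarrow> (\<exists>k::nat. x [^]\<^bsub>G\<^esub> ((2::nat) ^ k) = \<one>\<^bsub>G\<^esub>))"

lemma (in group) torsion_2_power_iff_ord:
  "torsion_2_power G \<longleftrightarrow> (\<forall>x\<in>carrier G. ord x \<noteq> 0 \<longrightarrow> (\<exists>k. ord x = 2 ^ k))"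
proof
  assume "torsion_2_power G"
  then have "\<exists>k. ord x dvd 2 ^ k" if "x \<in> carrier G" "ord x \<noteq> 0" for x
    using that by (auto simp: torsion_2_power_def pow_eq_id)
  then show "\<forall>x\<in>carrier G. ord x \<noteq> 0 \<longrightarrow> (\<exists>k. ord x = 2 ^ k)"
    by (metis divides_primepow_nat two_is_prime_nat)
next
  assume *: "\<forall>x\<in>carrier G. ord x \<noteq> 0 \<longrightarrow> (\<exists>k. ord x = 2 ^ k)"
  show "torsion_2_power G"
    unfolding torsion_2_power_def
  proof (intro ballI allI impI)
    fix x and n :: nat assume "x \<in> carrier G" "0 < n" "x [^] n = \<one>"
    then have "ord x \<noteq> 0" by (auto simp: pow_eq_id)
    with * \<open>x \<in> carrier G\<close> show "\<exists>k::nat. x [^] ((2::nat) ^ k) = \<one>"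
      by (metis dvd_refl pow_eq_id)
  qed
qed

lemma torsion_2_power_if_2_group:
  assumes "finite_2_group G \<or> infinite_2_group G"
  shows "torsion_2_power G"
  using assms
proof
  assume G: "finite_2_group G"
  then interpret group G by (simp add: finite_2_group_def)
  from G obtain k where k: "order G = 2 ^ k" by (auto simp: finite_2_group_def)
  have "x [^]\<^bsub>G\<^esub> ((2::nat) ^ k) = \<one>\<^bsub>G\<^esub>" if "x \<in> carrier G" for x
    using that k pow_order_eq_1 by metis
  then show ?thesis by (auto simp: torsion_2_power_def)
qed (auto simp: infinite_2_group_def group.torsion_2_power_iff_ord)

lemma finitely_generated_if_2_group:
  assumes "finite_2_group G \<or> infinite_2_group G"
  shows "finitely_generated G"
  using assms
proof
  assume G: "finite_2_group G"
  then interpret group G by (simp add: finite_2_group_def)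
  have "generate G (carrier G) = carrier G"
    using generate_incl[OF subset_refl] by (auto intro: generate.incl)
  with G show ?thesis by (auto simp: finite_2_group_def finitely_generated_def)
qed (simp add: infinite_2_group_def)

lemma infinite_2_group_iso:
  assumes "group G" "group H" "G \<cong> H" "infinite_2_group H"
  shows "infinite_2_group G"
proof -
  interpret G: group G by fact
  interpret H: group H by fact
  obtain g where g: "g \<in> iso H G"
    using assms(3) G.iso_sym by (auto simp: is_iso_def)
  interpret g: group_hom H G g
    using g by unfold_locales (auto simp: iso_def)
  have bij: "bij_betw g (carrier H) (carrier G)" using g by (simp add: iso_def)
  obtain S where S: "finite S" "S \<subseteq> carrier H" "generate H S = carrier H"
    using assms(4) by (auto simp: infinite_2_group_def finitely_generated_def)
  have "generate G (g ` S) = carrier G"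
    using g.generate_img[OF S(2)] S(3) bij by (simp add: bij_betw_def)
  then have "finitely_generated G"
    using S unfolding finitely_generated_def by (metis finite_imageI g.hom_closed image_subset_iff subset_iff)
  moreover have "infinite (carrier G)"
    using assms(4) bij by (auto simp: infinite_2_group_def bij_betw_finite)
  moreover have "torsion_2_power G"
    unfolding torsion_2_power_def
  proof (intro ballI allI impI)
    fix x and n :: nat assume x: "x \<in> carrier G" "0 < n" "x [^]\<^bsub>G\<^esub> n = \<one>\<^bsub>G\<^esub>"
    then obtain y where y: "y \<in> carrier H" "x = g y" using bij by (auto simp: bij_betw_def)
    have eq: "g (y [^]\<^bsub>H\<^esub> (m::nat)) = x [^]\<^bsub>G\<^esub> m" for m
      using y by (simp add: g.hom_nat_pow)
    have "y [^]\<^bsub>H\<^esub> n = \<one>\<^bsub>H\<^esub>"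
      using bij eq[of n] x y by (metis H.nat_pow_closed H.one_closed bij_betw_imp_inj_on g.hom_one inj_onD)
    then obtain k :: nat where "y [^]\<^bsub>H\<^esub> ((2::nat) ^ k) = \<one>\<^bsub>H\<^esub>"
      using assms(4) torsion_2_power_if_2_group x y unfolding torsion_2_power_def by blast
    then show "\<exists>k::nat. x [^]\<^bsub>G\<^esub> ((2::nat) ^ k) = \<one>\<^bsub>G\<^esub>"
      using eq by (metis g.hom_one)
  qed
  ultimately show ?thesis
    using G.torsion_2_power_iff_ord assms(1) by (simp add: infinite_2_group_def)
qed

section \<open>Subgroups of index two\<close>

lemma (in group) index_two_coset:
  assumes D: "subgroup D G" and card: "card (rcosets D) = 2"
    and x: "x \<in> carrier G" "x \<notin> D"
  shows "carrier G = D \<union> (D #> x)"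
proof -
  interpret D: subgroup D G by fact
  have fin: "finite (rcosets D)" using card by (metis card.infinite zero_neq_numeral)
  have "D \<in> rcosets D" using D by (simp add: D.subgroup_in_rcosets is_group)
  moreover have "D #> x \<in> rcosets D" using x by (auto simp: RCOSETS_def)
  moreover have "x \<in> D #> x" using x D by (simp add: rcos_self)
  then have "D #> x \<noteq> D" using x by blast
  ultimately have "{D, D #> x} = rcosets D"
    using card fin by (intro card_subset_eq) auto
  then show ?thesis using rcosets_part_G[OF D] by auto
qed

lemma (in group) index_two_proper:
  assumes D: "subgroup D G" and card: "card (rcosets D) = 2"
  obtains x where "x \<in> carrier G" "x \<notin> D"
proof -
  interpret D: subgroup D G by fact
  have "rcosets D \<noteq> {D}" using card by auto
  moreover have "D \<in> rcosets D" using D by (simp add: D.subgroup_in_rcosets is_group)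
  ultimately obtain N where N: "N \<in> rcosets D" "N \<noteq> D" by auto
  then obtain x where x: "x \<in> carrier G" "N = D #> x" by (auto simp: RCOSETS_def)
  then have "x \<notin> D" using N coset_join2[OF _ D] by blast
  with x that show thesis by blast
qed

text \<open>
  If \<open>x \<notin> D\<close> then \<open>D\<close> and \<open>D x\<close> are the only cosets, and \<open>x\<^sup>2 \<in> D x\<close> would put \<open>x\<close> into \<open>D\<close>.
\<close>

lemma (in group) index_two_square:
  assumes D: "subgroup D G" and card: "card (rcosets D) = 2"
    and x: "x \<in> carrier G"
  shows "x \<otimes> x \<in> D"
proof (cases "x \<in> D")
  case True
  then show ?thesis using D by (simp add: subgroup.m_closed)
next
  case False
  interpret D: subgroup D G by fact
  show ?thesis
  proof (rule ccontr)
    assume "x \<otimes> x \<notin> D"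
    then have "x \<otimes> x \<in> D #> x" using index_two_coset[OF D card x False] x by blast
    then obtain d where d: "d \<in> D" "x \<otimes> x = d \<otimes> x" by (auto simp: r_coset_def)
    then have "x = d" using x D.mem_carrier by simp
    with d False show False by simp
  qed
qed

lemma (in group) finitely_generated_index_two:
  assumes card: "card (rcosets (generate G S)) = 2" and S: "finite S" "S \<subseteq> carrier G"
  shows "finitely_generated G"
proof -
  have D: "subgroup (generate G S) G" using S by (simp add: generate_is_subgroup)
  obtain x where x: "x \<in> carrier G" "x \<notin> generate G S"
    using index_two_proper[OF D card] .
  have "carrier G \<subseteq> generate G (insert x S)"
  proof
    fix y assume "y \<in> carrier G"
    then consider "y \<in> generate G S" | d where "d \<in> generate G S" "y = d \<otimes> x"
      using index_two_coset[OF D card x] by (auto simp: r_coset_def)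
    then show "y \<in> generate G (insert x S)"
      using mono_generate[of S "insert x S"]
      by cases (auto intro: generate.eng generate.incl)
  qed
  then have "generate G (insert x S) = carrier G"
    using generate_incl[of "insert x S"] S x by blast
  with S x show ?thesis
    unfolding finitely_generated_def by (metis finite.insertI insert_subset)
qed

lemma (in group) torsion_2_power_index_two:
  assumes D: "subgroup D G" and card: "card (rcosets D) = 2"
    and tor: "torsion_2_power (G\<lparr>carrier := D\<rparr>)"
  shows "torsion_2_power G"
  unfolding torsion_2_power_def
proof (intro ballI allI impI)
  fix x and n :: nat assume x: "x \<in> carrier G" "0 < n" "x [^] n = \<one>"
  have sq: "(x \<otimes> x) [^] m = x [^] (2 * m)" for m :: nat
    using x nat_pow_pow[of x 2 m] by (simp add: numeral_2_eq_2)
  have "(x \<otimes> x) [^] n = \<one>" using x by (simp add: sq mult_2 nat_pow_mult[symmetric])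
  moreover have "x \<otimes> x \<in> D" using index_two_square[OF D card x(1)] .
  ultimately obtain k :: nat where "(x \<otimes> x) [^] ((2::nat) ^ k) = \<one>"
    using tor x(2) unfolding torsion_2_power_def by (auto simp: nat_pow_consistent[symmetric])
  then have "x [^] ((2::nat) ^ Suc k) = \<one>" by (simp add: sq)
  then show "\<exists>k::nat. x [^] ((2::nat) ^ k) = \<one>" by blast
qed

section \<open>The action of one factor on normal forms\<close>

text \<open>
  The system \<open>R\<close> represents the nontrivial right cosets only; the trivial coset is kept apart
  because in a normal form it contributes no letter.
\<close>

lemma (in group) transversal_exists:
  assumes D: "subgroup D G"
  shows "\<exists>R\<subseteq>carrier G. bij_betw (\<lambda>(d, r). d \<otimes> r) (D \<times> R) (carrier G - D)"
proof -
  interpret D: subgroup D G by fact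
  define rep where "rep N = (SOME r. r \<in> N)" for N :: "'a set"
  define R where "R = rep ` (rcosets D - {D})"
  have R: "r \<in> carrier G \<and> r \<notin> D \<and> rep (D #> r) = r" if "r \<in> R" for r
  proof -
    from that obtain x where x: "x \<in> carrier G" "D #> x \<noteq> D" "r = rep (D #> x)"
      by (auto simp: R_def RCOSETS_def)
    then have r: "r \<in> D #> x" using rcos_self[OF x(1) D] unfolding rep_def by (metis someI)
    then have "D #> x = D #> r" using x(1) D by (intro repr_independence)
    moreover have rG: "r \<in> carrier G" using r x D.subset r_coset_subset_G by blast
    ultimately show ?thesis using x coset_join2[OF rG D] by metis
  qed
  have coset: "D #> (d \<otimes> r) = D #> r" if "d \<in> D" "r \<in> carrier G" for d r
    using that D repr_independence[OF _ that(2) D, of "d \<otimes> r"] by (auto simp: r_coset_def)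
  have "inj_on (\<lambda>(d, r). d \<otimes> r) (D \<times> R)"
  proof (rule inj_onI, clarify)
    fix d r d' r' assume *: "d \<in> D" "r \<in> R" "d' \<in> D" "r' \<in> R" "d \<otimes> r = d' \<otimes> r'"
    then have "r = r'" by (metis R coset)
    moreover from this have "d = d'" using * R D.mem_carrier by (metis r_cancel)
    ultimately show "d = d' \<and> r = r'" by blast
  qed
  moreover have "(\<lambda>(d, r). d \<otimes> r) ` (D \<times> R) = carrier G - D"
  proof (intro equalityI subsetI)
    fix y assume "y \<in> (\<lambda>(d, r). d \<otimes> r) ` (D \<times> R)"
    then obtain d r where y: "d \<in> D" "r \<in> R" "y = d \<otimes> r" by auto
    have "y \<notin> D"
    proof
      assume "y \<in> D"
      then have "inv d \<otimes> y \<in> D" using y by simp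
      then show False using y R[of r] D.mem_carrier by (simp add: m_assoc[symmetric])
    qed
    then show "y \<in> carrier G - D" using y R D.mem_carrier by simp
  next
    fix y assume y: "y \<in> carrier G - D"
    define r where "r = rep (D #> y)"
    have self: "y \<in> D #> y" using y D by (simp add: rcos_self)
    then have "r \<in> D #> y" unfolding r_def rep_def by (metis someI)
    then have "D #> y = D #> r" using y D by (intro repr_independence) auto
    with self obtain d where "d \<in> D" "y = d \<otimes> r" by (auto simp: r_coset_def)
    moreover have "D #> y \<noteq> D" using self y by blast
    then have "r \<in> R" using y by (auto simp: R_def r_def RCOSETS_def)
    ultimately show "y \<in> (\<lambda>(d, r). d \<otimes> r) ` (D \<times> R)" by force
  qed
  ultimately have "bij_betw (\<lambda>(d, r). d \<otimes> r) (D \<times> R) (carrier G - D)"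
    by (simp add: bij_betw_def)
  moreover have "R \<subseteq> carrier G" using R by blast
  ultimately show ?thesis by blast
qed

definition transversal ::
    "('c, 'y) monoid_scheme \<Rightarrow> ('m, 'x) monoid_scheme \<Rightarrow> ('c \<Rightarrow> 'm) \<Rightarrow> 'm set" where
  "transversal B M \<iota> = (SOME R. R \<subseteq> carrier M \<and> bij_betw (\<lambda>(c, r). \<iota> c \<otimes>\<^bsub>M\<^esub> r) (carrier B \<times> R)
     (carrier M - \<iota> ` carrier B))"

lemma
  assumes "group_hom B M \<iota>" and inj: "inj_on \<iota> (carrier B)"
  shows transversal_subset: "transversal B M \<iota> \<subseteq> carrier M"
    and bij_betw_transversal: "bij_betw (\<lambda>(c, r). \<iota> c \<otimes>\<^bsub>M\<^esub> r) (carrier B \<times> transversal B M \<iota>)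
     (carrier M - \<iota> ` carrier B)"
proof -
  interpret group_hom B M \<iota> by fact
  obtain R where RM: "R \<subseteq> carrier M"
    and R: "bij_betw (\<lambda>(d, r). d \<otimes>\<^bsub>M\<^esub> r) (\<iota> ` carrier B \<times> R) (carrier M - \<iota> ` carrier B)"
    using H.transversal_exists[OF img_is_subgroup] by blast
  have "bij_betw (map_prod \<iota> id) (carrier B \<times> R) (\<iota> ` carrier B \<times> R)"
    using inj by (intro bij_betw_map_prod) (auto simp: bij_betw_def)
  moreover have "(\<lambda>(d, r). d \<otimes>\<^bsub>M\<^esub> r) \<circ> map_prod \<iota> id = (\<lambda>(c, r). \<iota> c \<otimes>\<^bsub>M\<^esub> r)" by auto
  ultimately have "bij_betw (\<lambda>(c, r). \<iota> c \<otimes>\<^bsub>M\<^esub> r) (carrier B \<times> R) (carrier M - \<iota> ` carrier B)"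
    using bij_betw_trans[OF _ R] by metis
  with RM have "\<exists>R. R \<subseteq> carrier M \<and> bij_betw (\<lambda>(c, r). \<iota> c \<otimes>\<^bsub>M\<^esub> r) (carrier B \<times> R)
      (carrier M - \<iota> ` carrier B)"
    by blast
  from someI_ex[OF this] show "transversal B M \<iota> \<subseteq> carrier M"
    and "bij_betw (\<lambda>(c, r). \<iota> c \<otimes>\<^bsub>M\<^esub> r) (carrier B \<times> transversal B M \<iota>)
      (carrier M - \<iota> ` carrier B)"
    unfolding transversal_def by auto
qed

text \<open>
  Van der Waerden's action, seen from one factor \<open>M\<close> with amalgamated subgroup \<open>\<iota> B\<close>. A normal form
  is a pair of an element of \<open>B\<close> and a word \<open>w \<in> W\<close> in coset representatives, tagged by the factor
  that they come from; \<open>V\<close> consists of the words that do not begin with a representative from \<open>M\<close>.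
  Splitting off a leading representative of \<open>M\<close> turns normal forms into pairs from \<open>M \<times> V\<close>, and
  \<open>M\<close> acts on these by left multiplication in the first component. The locale is instantiated once
  for each factor of an amalgamated product, with the same set of normal forms.
\<close>

locale amalgam_factor = M: group M + B: group B
  for M :: "('m, 'x) monoid_scheme" and B :: "('c, 'y) monoid_scheme" +
  fixes \<iota> :: "'c \<Rightarrow> 'm" and tag :: "'m \<Rightarrow> 'l" and R :: "'m set" and W V :: "'l list set"
  assumes hom: "\<iota> \<in> hom B M"
    and inj: "inj_on \<iota> (carrier B)"
    and R_closed: "r \<in> R \<Longrightarrow> r \<in> carrier M"
    and transversal: "bij_betw (\<lambda>(c, r). \<iota> c \<otimes>\<^bsub>M\<^esub> r) (carrier B \<times> R) (carrier M - \<iota> ` carrier B)"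
    and inj_tag: "inj tag"
    and W_eq: "W = V \<union> {tag r # w | r w. r \<in> R \<and> w \<in> V}"
    and V_no_tag: "tag r # w \<notin> V"
begin

definition pop :: "'c \<times> 'l list \<Rightarrow> 'm \<times> 'l list" where
  "pop x = (if snd x \<in> V then (\<iota> (fst x), snd x)
     else (\<iota> (fst x) \<otimes>\<^bsub>M\<^esub> inv_into UNIV tag (hd (snd x)), tl (snd x)))"

lemma pop_V: "w \<in> V \<Longrightarrow> pop (c, w) = (\<iota> c, w)"
  by (simp add: pop_def)

lemma pop_tag: "pop (c, tag r # w) = (\<iota> c \<otimes>\<^bsub>M\<^esub> r, w)"
  using V_no_tag inj_tag by (simp add: pop_def)

lemma iota_closed: "c \<in> carrier B \<Longrightarrow> \<iota> c \<in> carrier M"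
  using hom by (auto simp: hom_def)

lemma coset_closed: "c \<in> carrier B \<Longrightarrow> r \<in> R \<Longrightarrow> \<iota> c \<otimes>\<^bsub>M\<^esub> r \<in> carrier M - \<iota> ` carrier B"
  using bij_betwE[OF transversal] by auto

lemma bij_pop: "bij_betw pop (carrier B \<times> W) (carrier M \<times> V)"
  unfolding bij_betw_def
proof
  have cases: "(\<exists>w\<in>V. x = (fst x, w)) \<or> (\<exists>r\<in>R. \<exists>w\<in>V. x = (fst x, tag r # w))"
    if "x \<in> carrier B \<times> W" for x
    using that W_eq by auto
  show "inj_on pop (carrier B \<times> W)"
  proof (rule inj_onI)
    fix x y assume x: "x \<in> carrier B \<times> W" and y: "y \<in> carrier B \<times> W" and eq: "pop x = pop y"
    have cB: "fst x \<in> carrier B" "fst y \<in> carrier B" using x y by auto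
    from cases[OF x] cases[OF y] show "x = y"
    proof (elim disjE bexE)
      fix w w' assume w: "w \<in> V" "x = (fst x, w)" "w' \<in> V" "y = (fst y, w')"
      then have "\<iota> (fst x) = \<iota> (fst y)" "w = w'" using eq pop_V by (metis Pair_inject)+
      then show ?thesis using w inj cB by (metis inj_onD)
    next
      fix w r' w' assume w: "w \<in> V" "x = (fst x, w)" "r' \<in> R" "w' \<in> V" "y = (fst y, tag r' # w')"
      then have "\<iota> (fst x) = \<iota> (fst y) \<otimes>\<^bsub>M\<^esub> r'" using eq pop_V pop_tag by (metis Pair_inject)
      then show ?thesis using coset_closed[OF cB(2) w(3)] cB by (metis DiffD2 imageI)
    next
      fix r w w' assume w: "r \<in> R" "w \<in> V" "x = (fst x, tag r # w)" "w' \<in> V" "y = (fst y, w')"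
      then have "\<iota> (fst y) = \<iota> (fst x) \<otimes>\<^bsub>M\<^esub> r" using eq pop_V pop_tag by (metis Pair_inject)
      then show ?thesis using coset_closed[OF cB(1) w(1)] cB by (metis DiffD2 imageI)
    next
      fix r w r' w' assume w: "r \<in> R" "w \<in> V" "x = (fst x, tag r # w)"
        "r' \<in> R" "w' \<in> V" "y = (fst y, tag r' # w')"
      then have "\<iota> (fst x) \<otimes>\<^bsub>M\<^esub> r = \<iota> (fst y) \<otimes>\<^bsub>M\<^esub> r'" "w = w'"
        using eq pop_tag by (metis Pair_inject)+
      moreover from this have "(fst x, r) = (fst y, r')"
        using cB w by (intro inj_onD[OF bij_betw_imp_inj_on[OF transversal]]) auto
      ultimately show ?thesis using w by (metis Pair_inject)
    qed
  qed
  show "pop ` (carrier B \<times> W) = carrier M \<times> V"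
  proof (intro equalityI subsetI)
    fix z assume "z \<in> pop ` (carrier B \<times> W)"
    then obtain x where x: "x \<in> carrier B \<times> W" "z = pop x" by blast
    have cB: "fst x \<in> carrier B" using x by auto
    from cases[OF x(1)] show "z \<in> carrier M \<times> V"
    proof (elim disjE bexE)
      fix w assume "w \<in> V" "x = (fst x, w)"
      then have "z = (\<iota> (fst x), w)" using x pop_V by metis
      then show ?thesis using \<open>w \<in> V\<close> cB iota_closed by simp
    next
      fix r w assume "r \<in> R" "w \<in> V" "x = (fst x, tag r # w)"
      then have "z = (\<iota> (fst x) \<otimes>\<^bsub>M\<^esub> r, w)" using x pop_tag by metis
      then show ?thesis using \<open>w \<in> V\<close> \<open>r \<in> R\<close> cB coset_closed by simp
    qed
  next
    fix z assume "z \<in> carrier M \<times> V"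
    then obtain m w where z: "z = (m, w)" "m \<in> carrier M" "w \<in> V" by auto
    show "z \<in> pop ` (carrier B \<times> W)"
    proof (cases "m \<in> \<iota> ` carrier B")
      case True
      then obtain c where "c \<in> carrier B" "m = \<iota> c" by blast
      then show ?thesis using z pop_V[of w c] W_eq by (intro image_eqI[of _ _ "(c, w)"]) auto
    next
      case False
      then have "m \<in> (\<lambda>(c, r). \<iota> c \<otimes>\<^bsub>M\<^esub> r) ` (carrier B \<times> R)"
        using z transversal by (simp add: bij_betw_def)
      then obtain c r where "c \<in> carrier B" "r \<in> R" "m = \<iota> c \<otimes>\<^bsub>M\<^esub> r" by auto
      then show ?thesis using z pop_tag[of c r w] W_eq
        by (intro image_eqI[of _ _ "(c, tag r # w)"]) auto
    qed
  qed
qed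

definition act :: "'m \<Rightarrow> 'c \<times> 'l list \<Rightarrow> 'c \<times> 'l list" where
  "act m x = inv_into (carrier B \<times> W) pop (m \<otimes>\<^bsub>M\<^esub> fst (pop x), snd (pop x))"

lemma pop_closed: "x \<in> carrier B \<times> W \<Longrightarrow> pop x \<in> carrier M \<times> V"
  using bij_betwE[OF bij_pop] by blast

lemma act_eqI:
  assumes "y \<in> carrier B \<times> W" "pop y = (m \<otimes>\<^bsub>M\<^esub> fst (pop x), snd (pop x))"
  shows "act m x = y"
  unfolding act_def using assms bij_betw_inv_into_left[OF bij_pop] by metis

lemma
  assumes "m \<in> carrier M" "x \<in> carrier B \<times> W"
  shows act_closed: "act m x \<in> carrier B \<times> W"
    and pop_act: "pop (act m x) = (m \<otimes>\<^bsub>M\<^esub> fst (pop x), snd (pop x))"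
proof -
  have *: "(m \<otimes>\<^bsub>M\<^esub> fst (pop x), snd (pop x)) \<in> carrier M \<times> V"
    using pop_closed[OF assms(2)] assms(1) by auto
  show "act m x \<in> carrier B \<times> W"
    unfolding act_def using * bij_pop by (metis bij_betw_def inv_into_into)
  show "pop (act m x) = (m \<otimes>\<^bsub>M\<^esub> fst (pop x), snd (pop x))"
    unfolding act_def using * bij_betw_inv_into_right[OF bij_pop] by blast
qed

lemma act_one: "x \<in> carrier B \<times> W \<Longrightarrow> act \<one>\<^bsub>M\<^esub> x = x"
  by (rule act_eqI) (use pop_closed[of x] in auto)

lemma act_mult:
  assumes "m \<in> carrier M" "n \<in> carrier M" "x \<in> carrier B \<times> W"
  shows "act m (act n x) = act (m \<otimes>\<^bsub>M\<^esub> n) x"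
proof (rule act_eqI)
  show "act (m \<otimes>\<^bsub>M\<^esub> n) x \<in> carrier B \<times> W" using assms by (simp add: act_closed)
  have "fst (pop x) \<in> carrier M" using pop_closed[OF assms(3)] by auto
  then show "pop (act (m \<otimes>\<^bsub>M\<^esub> n) x) = (m \<otimes>\<^bsub>M\<^esub> fst (pop (act n x)), snd (pop (act n x)))"
    using assms by (simp add: pop_act M.m_assoc)
qed

text \<open>
  On the amalgamated subgroup the action does not depend on the factor. This is what lets the
  actions of the two factors combine to an action of the amalgamated product.
\<close>

lemma act_iota:
  assumes "c \<in> carrier B" "c' \<in> carrier B" "w \<in> W"
  shows "act (\<iota> c) (c', w) = (c \<otimes>\<^bsub>B\<^esub> c', w)"
proof (rule act_eqI)
  show "(c \<otimes>\<^bsub>B\<^esub> c', w) \<in> carrier B \<times> W" using assms by simp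
  have mult: "\<iota> (c \<otimes>\<^bsub>B\<^esub> c') = \<iota> c \<otimes>\<^bsub>M\<^esub> \<iota> c'" using assms hom by (simp add: hom_def)
  from assms(3) consider "w \<in> V" | r v where "r \<in> R" "w = tag r # v" using W_eq by blast
  then show "pop (c \<otimes>\<^bsub>B\<^esub> c', w) = (\<iota> c \<otimes>\<^bsub>M\<^esub> fst (pop (c', w)), snd (pop (c', w)))"
  proof cases
    case 1
    then show ?thesis by (simp add: pop_V mult)
  next
    case 2
    then show ?thesis using assms by (simp add: pop_tag mult M.m_assoc iota_closed R_closed)
  qed
qed

text \<open>
  An element outside the amalgamated subgroup adds a letter, as long as the word does not already
  begin with one from the same factor.
\<close>

lemma act_push:
  assumes "m \<in> carrier M - \<iota> ` carrier B" "c \<in> carrier B" "w \<in> V"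
  shows "\<exists>c'\<in>carrier B. \<exists>r\<in>R. act m (c, w) = (c', tag r # w)"
proof -
  interpret iota: group_hom B M \<iota> by unfold_locales (rule hom)
  have "m \<otimes>\<^bsub>M\<^esub> \<iota> c \<notin> \<iota> ` carrier B"
  proof
    assume "m \<otimes>\<^bsub>M\<^esub> \<iota> c \<in> \<iota> ` carrier B"
    then have "m \<otimes>\<^bsub>M\<^esub> \<iota> c \<otimes>\<^bsub>M\<^esub> inv\<^bsub>M\<^esub> \<iota> c \<in> \<iota> ` carrier B"
      using assms iota.img_is_subgroup
      by (meson imageI subgroup.m_closed subgroup.m_inv_closed)
    then show False using assms iota_closed by (simp add: M.m_assoc)
  qed
  then have "m \<otimes>\<^bsub>M\<^esub> \<iota> c \<in> (\<lambda>(c, r). \<iota> c \<otimes>\<^bsub>M\<^esub> r) ` (carrier B \<times> R)"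
    using assms iota_closed transversal by (simp add: bij_betw_def)
  then obtain c' r where "c' \<in> carrier B" "r \<in> R" "m \<otimes>\<^bsub>M\<^esub> \<iota> c = \<iota> c' \<otimes>\<^bsub>M\<^esub> r" by auto
  then have "act m (c, w) = (c', tag r # w)"
    using assms W_eq by (intro act_eqI) (auto simp: pop_V pop_tag)
  with \<open>c' \<in> carrier B\<close> \<open>r \<in> R\<close> show ?thesis by blast
qed

lemma act_inj:
  assumes "m \<in> carrier M" "n \<in> carrier M" "w \<in> V" "act m (\<one>\<^bsub>B\<^esub>, w) = act n (\<one>\<^bsub>B\<^esub>, w)"
  shows "m = n"
proof -
  have "pop (act m (\<one>\<^bsub>B\<^esub>, w)) = pop (act n (\<one>\<^bsub>B\<^esub>, w))" using assms by simp
  moreover have "(\<one>\<^bsub>B\<^esub>, w) \<in> carrier B \<times> W" using assms W_eq by auto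
  ultimately have "m \<otimes>\<^bsub>M\<^esub> \<iota> \<one>\<^bsub>B\<^esub> = n \<otimes>\<^bsub>M\<^esub> \<iota> \<one>\<^bsub>B\<^esub>"
    using assms(1,2,3) by (simp add: pop_act pop_V)
  then show ?thesis using assms iota_closed by simp
qed

end

section \<open>Amalgamated free products\<close>

text \<open>
  These are the hypotheses under which the congruence on words defines an honest amalgam, that is,
  under which both factors embed.
\<close>

locale amalgam = G: group G + H: group H
  for G :: "('g, 'm) monoid_scheme" and H :: "('h, 'n) monoid_scheme" +
  fixes C :: "'g set" and \<phi> :: "'g \<Rightarrow> 'h"
  assumes C: "subgroup C G"
    and hom: "\<phi> \<in> hom (G\<lparr>carrier := C\<rparr>) H"
    and inj: "inj_on \<phi> C"
begin

abbreviation "B \<equiv> G\<lparr>carrier := C\<rparr>"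
abbreviation "E \<equiv> amalgam_cong G H C \<phi>"
abbreviation "Words \<equiv> amalgam_words G H"
abbreviation "A \<equiv> amalgamated_product G H C \<phi>"
abbreviation "cls u \<equiv> E `` {u}"

sublocale B: group B
  using C by (rule G.subgroup_imp_group)

sublocale phi: group_hom B H \<phi>
  using hom by unfold_locales

lemma C_closed: "c \<in> C \<Longrightarrow> c \<in> carrier G"
  using C by (rule subgroup.mem_carrier)

lemma phi_closed: "c \<in> C \<Longrightarrow> \<phi> c \<in> carrier H"
  using phi.hom_closed by simp

lemma Words_simps [simp]:
  "[] \<in> Words"
  "l # u \<in> Words \<longleftrightarrow> l \<in> carrier G <+> carrier H \<and> u \<in> Words"
  "u @ v \<in> Words \<longleftrightarrow> u \<in> Words \<and> v \<in> Words"
  by (auto simp: amalgam_words_def)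

lemma Inl_letter [simp]: "Inl g \<in> S <+> T \<longleftrightarrow> g \<in> S"
  and Inr_letter [simp]: "Inr h \<in> S <+> T \<longleftrightarrow> h \<in> T"
  by auto

lemma cong_Words: "(u, v) \<in> E \<Longrightarrow> u \<in> Words \<and> v \<in> Words"
  by (induction rule: amalgam_cong.induct) (auto simp: C_closed phi_closed)

lemma equiv_E: "equiv Words E"
proof (rule equivI)
  show "E \<subseteq> Words \<times> Words" using cong_Words by auto
  show "refl_on Words E" by (simp add: refl_on_def amalgam_cong.refl)
  show "sym E" by (meson amalgam_cong.sym symI)
  show "trans E" by (meson amalgam_cong.trans transI)
qed

lemma cls_eq_iff: "u \<in> Words \<Longrightarrow> v \<in> Words \<Longrightarrow> cls u = cls v \<longleftrightarrow> (u, v) \<in> E"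
  using eq_equiv_class_iff[OF equiv_E] .

lemma cls_eqI: "(u, v) \<in> E \<Longrightarrow> cls u = cls v"
  by (rule equiv_class_eq[OF equiv_E])

lemma carrier_A: "carrier A = cls ` Words"
  by (auto simp: amalgamated_product_def quotient_def)

lemma cls_closed: "u \<in> Words \<Longrightarrow> cls u \<in> carrier A"
  by (simp add: carrier_A)

lemma one_A: "\<one>\<^bsub>A\<^esub> = cls []"
  by (simp add: amalgamated_product_def)

lemma mult_A:
  assumes "u \<in> Words" "v \<in> Words"
  shows "cls u \<otimes>\<^bsub>A\<^esub> cls v = cls (u @ v)"
proof -
  have "cls (u' @ v') = cls (u @ v)" if "u' \<in> cls u" "v' \<in> cls v" for u' v'
    using that by (intro cls_eqI amalgam_cong.append) (auto intro: amalgam_cong.sym)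
  moreover have "u \<in> cls u" "v \<in> cls v"
    using assms by (auto intro: amalgam_cong.refl)
  ultimately have "(\<Union>u'\<in>cls u. \<Union>v'\<in>cls v. cls (u' @ v')) = cls (u @ v)" by blast
  then show ?thesis by (simp add: amalgamated_product_def)
qed

lemma cong_context:
  assumes "(u, v) \<in> E" "p \<in> Words" "q \<in> Words"
  shows "(p @ u @ q, p @ v @ q) \<in> E"
  using assms by (intro amalgam_cong.append amalgam_cong.refl)

lemma left_inverse_word: "u \<in> Words \<Longrightarrow> \<exists>v\<in>Words. (v @ u, []) \<in> E"
proof (induction u)
  case Nil
  then show ?case using amalgam_cong.refl[of "[]"] by force
next
  case (Cons l u)
  then obtain v where v: "v \<in> Words" "(v @ u, []) \<in> E" by auto
  obtain l' where l': "[l'] \<in> Words" "([l', l], []) \<in> E"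
  proof (cases l)
    case (Inl g)
    then have "g \<in> carrier G" using Cons.prems by simp
    then have "([Inl (inv\<^bsub>G\<^esub> g), Inl g], [Inl \<one>\<^bsub>G\<^esub>]) \<in> E"
      using amalgam_cong.mult_left[of "inv\<^bsub>G\<^esub> g" G g] by simp
    with that[of "Inl (inv\<^bsub>G\<^esub> g)"] \<open>g \<in> carrier G\<close> Inl show thesis
      using amalgam_cong.trans amalgam_cong.one_left by (metis G.inv_closed Words_simps(1,2) Inl_letter)
  next
    case (Inr h)
    then have "h \<in> carrier H" using Cons.prems by simp
    then have "([Inr (inv\<^bsub>H\<^esub> h), Inr h], [Inr \<one>\<^bsub>H\<^esub>]) \<in> E"
      using amalgam_cong.mult_right[of "inv\<^bsub>H\<^esub> h" H h] by simp
    with that[of "Inr (inv\<^bsub>H\<^esub> h)"] \<open>h \<in> carrier H\<close> Inr show thesis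
      using amalgam_cong.trans amalgam_cong.one_right by (metis H.inv_closed Words_simps(1,2) Inr_letter)
  qed
  have "(v @ [l', l] @ u, v @ [] @ u) \<in> E"
    using v l' Cons.prems by (intro cong_context) auto
  then have "((v @ [l']) @ l # u, []) \<in> E" using v amalgam_cong.trans by fastforce
  then show ?case using v l' by (intro bexI[of _ "v @ [l']"]) auto
qed

sublocale A: group A
proof (rule groupI)
  fix x y z assume "x \<in> carrier A" "y \<in> carrier A" "z \<in> carrier A"
  then show "x \<otimes>\<^bsub>A\<^esub> y \<otimes>\<^bsub>A\<^esub> z = x \<otimes>\<^bsub>A\<^esub> (y \<otimes>\<^bsub>A\<^esub> z)"
    by (auto simp: carrier_A mult_A)
next
  fix x assume "x \<in> carrier A"
  then obtain u where u: "u \<in> Words" "x = cls u" by (auto simp: carrier_A)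
  then obtain v where "v \<in> Words" "(v @ u, []) \<in> E" using left_inverse_word by blast
  then show "\<exists>y\<in>carrier A. y \<otimes>\<^bsub>A\<^esub> x = \<one>\<^bsub>A\<^esub>"
    using u cls_eqI[of "v @ u" "[]"] by (auto simp: carrier_A mult_A one_A)
qed (auto simp: carrier_A mult_A one_A)

sublocale inl: group_hom G A "\<lambda>g. cls [Inl g]"
  by unfold_locales (auto simp: hom_def cls_closed mult_A intro!: cls_eqI[symmetric] amalgam_cong.mult_left)

sublocale inr: group_hom H A "\<lambda>h. cls [Inr h]"
  by unfold_locales (auto simp: hom_def cls_closed mult_A intro!: cls_eqI[symmetric] amalgam_cong.mult_right)

definition alternating :: "('a + 'b) list \<Rightarrow> bool" where
  "alternating = successively (\<lambda>l l'. isl l \<noteq> isl l')"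

definition normal_words :: "('g + 'h) list set" where
  "normal_words = {w. set w \<subseteq> transversal B G (\<lambda>c. c) <+> transversal B H \<phi> \<and> alternating w}"

sublocale left: amalgam_factor G B "\<lambda>c. c" Inl "transversal B G (\<lambda>c. c)" normal_words
  "{w \<in> normal_words. w = [] \<or> \<not> isl (hd w)}"
proof
  interpret incl: group_hom B G "\<lambda>c. c"
    by unfold_locales (auto simp: hom_def C_closed)
  show "(\<lambda>c. c) \<in> hom B G" by (rule incl.homh)
  show "r \<in> carrier G" if "r \<in> transversal B G (\<lambda>c. c)" for r
    using that transversal_subset[OF incl.group_hom_axioms] by auto
  show "bij_betw (\<lambda>(c, r). c \<otimes>\<^bsub>G\<^esub> r) (carrier B \<times> transversal B G (\<lambda>c. c))
    (carrier G - (\<lambda>c. c) ` carrier B)"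
    by (rule bij_betw_transversal[OF incl.group_hom_axioms]) simp
  show "normal_words = {w \<in> normal_words. w = [] \<or> \<not> isl (hd w)} \<union>
    {Inl r # w |r w. r \<in> transversal B G (\<lambda>c. c) \<and> w \<in> {w \<in> normal_words. w = [] \<or> \<not> isl (hd w)}}"
    (is "_ = ?V \<union> ?V'")
  proof (intro equalityI subsetI)
    fix w assume w: "w \<in> normal_words"
    show "w \<in> ?V \<union> ?V'"
    proof (cases "\<exists>r v. w = Inl r # v")
      case True
      then show ?thesis using w by (auto simp: normal_words_def alternating_def successively_Cons)
    next
      case False
      then show ?thesis using w by (cases w; cases "hd w") auto
    qed
  qed (auto simp: normal_words_def alternating_def successively_Cons)
qed auto

sublocale right: amalgam_factor H B \<phi> Inr "transversal B H \<phi>" normal_words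
  "{w \<in> normal_words. w = [] \<or> isl (hd w)}"
proof
  show "\<phi> \<in> hom B H" by (rule hom)
  show "inj_on \<phi> (carrier B)" using inj by simp
  show "r \<in> carrier H" if "r \<in> transversal B H \<phi>" for r
    using that transversal_subset[OF phi.group_hom_axioms] inj by auto
  show "bij_betw (\<lambda>(c, r). \<phi> c \<otimes>\<^bsub>H\<^esub> r) (carrier B \<times> transversal B H \<phi>)
    (carrier H - \<phi> ` carrier B)"
    using inj by (intro bij_betw_transversal[OF phi.group_hom_axioms]) simp
  show "normal_words = {w \<in> normal_words. w = [] \<or> isl (hd w)} \<union>
    {Inr r # w |r w. r \<in> transversal B H \<phi> \<and> w \<in> {w \<in> normal_words. w = [] \<or> isl (hd w)}}"
    (is "_ = ?V \<union> ?V'")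
  proof (intro equalityI subsetI)
    fix w assume w: "w \<in> normal_words"
    show "w \<in> ?V \<union> ?V'"
    proof (cases "\<exists>r v. w = Inr r # v")
      case True
      then show ?thesis using w by (auto simp: normal_words_def alternating_def successively_Cons)
    next
      case False
      then show ?thesis using w by (cases w; cases "hd w") auto
    qed
  qed (auto simp: normal_words_def alternating_def successively_Cons)
qed auto

abbreviation "normal_forms \<equiv> C \<times> normal_words"

definition word_act :: "('g + 'h) list \<Rightarrow> 'g \<times> ('g + 'h) list \<Rightarrow> 'g \<times> ('g + 'h) list" where
  "word_act u x = foldr (case_sum left.act right.act) u x"

lemma word_act_simps [simp]:
  "word_act [] x = x"
  "word_act (Inl g # u) x = left.act g (word_act u x)"
  "word_act (Inr h # u) x = right.act h (word_act u x)"
  "word_act (u @ v) x = word_act u (word_act v x)"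
  by (simp_all add: word_act_def)

lemma word_act_closed: "u \<in> Words \<Longrightarrow> x \<in> normal_forms \<Longrightarrow> word_act u x \<in> normal_forms"
proof (induction u)
  case (Cons l u)
  then show ?case using left.act_closed right.act_closed by (cases l) auto
qed simp

text \<open>
  Each defining relation of the amalgamated product is respected by the action on normal forms, so
  the action separates words that are not congruent.
\<close>

lemma cong_act:
  "(u, v) \<in> E \<Longrightarrow> \<forall>x\<in>normal_forms. word_act u x = word_act v x"
proof (induction rule: amalgam_cong.induct)
  case (append u u' v v')
  then show ?case using cong_Words word_act_closed by (metis word_act_simps(4))
next
  case (amalgamate c)
  then show ?case using left.act_iota right.act_iota by auto
qed (use left.act_one right.act_one left.act_mult right.act_mult in auto)

abbreviation base_form :: "'g \<times> ('g + 'h) list" where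
  "base_form \<equiv> (\<one>\<^bsub>G\<^esub>, [])"

lemma Nil_normal: "[] \<in> normal_words"
  by (simp add: normal_words_def alternating_def)

lemma base_form: "base_form \<in> normal_forms"
  using C Nil_normal by (simp add: subgroup.one_closed)

text \<open>
  Already the base form distinguishes the elements of a factor.
\<close>

lemma inl_inj: "inj_on (\<lambda>g. cls [Inl g]) (carrier G)"
proof (rule inj_onI)
  fix g g' assume g: "g \<in> carrier G" "g' \<in> carrier G" "cls [Inl g] = cls [Inl g']"
  then have "([Inl g], [Inl g']) \<in> E" by (simp add: cls_eq_iff)
  from cong_act[OF this] base_form have "word_act [Inl g] base_form = word_act [Inl g'] base_form"
    by blast
  with g show "g = g'" using left.act_inj[of g g' "[]"] Nil_normal by simp
qed

lemma inr_inj: "inj_on (\<lambda>h. cls [Inr h]) (carrier H)"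
proof (rule inj_onI)
  fix h h' assume h: "h \<in> carrier H" "h' \<in> carrier H" "cls [Inr h] = cls [Inr h']"
  then have "([Inr h], [Inr h']) \<in> E" by (simp add: cls_eq_iff)
  from cong_act[OF this] base_form have "word_act [Inr h] base_form = word_act [Inr h'] base_form"
    by blast
  with h show "h = h'" using right.act_inj[of h h' "[]"] Nil_normal by simp
qed

definition amalgamated_letters :: "('g + 'h) set" where
  "amalgamated_letters = C <+> \<phi> ` C"

definition reduced :: "('g + 'h) list \<Rightarrow> bool" where
  "reduced u \<longleftrightarrow> u \<in> Words \<and> alternating u \<and> set u \<inter> amalgamated_letters = {}"

text \<open>
  Reading a reduced word from the right, each letter adds one letter to the normal form, because the
  previous one came from the other factor. In particular the normal form reached from the base form
  is not the base form.
\<close>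

lemma reduced_word_act:
  assumes "reduced u" "u \<noteq> []"
  shows "\<exists>c l w. word_act u base_form = (c, l # w) \<and> isl l = isl (hd u)"
  using assms
proof (induction u)
  case (Cons l u)
  then have u: "reduced u" and l: "[l] \<in> Words" "l \<notin> amalgamated_letters"
    by (auto simp: reduced_def alternating_def successively_Cons)
  obtain c w where cw: "word_act u base_form = (c, w)" by fastforce
  then have c: "c \<in> C" "w \<in> normal_words"
    using word_act_closed[OF _ base_form, of u] u by (auto simp: reduced_def)
  have hd: "w = [] \<or> isl (hd w) \<noteq> isl l"
  proof (cases "u = []")
    case False
    with Cons.IH[OF u] cw Cons.prems show ?thesis
      by (auto simp: reduced_def alternating_def successively_Cons)
  qed (use cw in simp)
  show ?case
  proof (cases l)
    case (Inl g)
    then have "g \<in> carrier G - C" using l by (auto simp: amalgamated_letters_def)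
    then show ?thesis using left.act_push[of g c w] c hd Inl cw by force
  next
    case (Inr h)
    then have "h \<in> carrier H - \<phi> ` C" using l by (auto simp: amalgamated_letters_def)
    then show ?thesis using right.act_push[of h c w] c hd Inr cw by force
  qed
qed simp

lemma reduced_nontrivial:
  assumes "reduced u" "u \<noteq> []"
  shows "cls u \<noteq> \<one>\<^bsub>A\<^esub>"
proof
  assume "cls u = \<one>\<^bsub>A\<^esub>"
  then have "(u, []) \<in> E" using assms by (simp add: one_A cls_eq_iff reduced_def)
  from cong_act[OF this] base_form have "word_act u base_form = base_form" by auto
  with reduced_word_act[OF assms] show False by auto
qed

end

section \<open>Torsion in amalgamated free products\<close>

lemma (in group)
  assumes "x \<in> carrier G" "y \<in> carrier G"
  shows inv_mult_cancel: "inv x \<otimes> (x \<otimes> y) = y" and mult_inv_cancel: "x \<otimes> (inv x \<otimes> y) = y"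
  using assms by (simp_all add: m_assoc[symmetric])

lemma (in group) conj_eq_one_iff:
  assumes "b \<in> carrier G" "x \<in> carrier G"
  shows "b \<otimes> x \<otimes> inv b = \<one> \<longleftrightarrow> x = \<one>"
proof
  assume "b \<otimes> x \<otimes> inv b = \<one>"
  then have "inv b \<otimes> (b \<otimes> x \<otimes> inv b) \<otimes> b = \<one>" using assms by simp
  then show "x = \<one>" using assms by (simp add: m_assoc inv_mult_cancel)
qed (use assms in simp)

lemma (in group) conj_nat_pow:
  assumes "b \<in> carrier G" "x \<in> carrier G"
  shows "(b \<otimes> x \<otimes> inv b) [^] (n::nat) = b \<otimes> x [^] n \<otimes> inv b"
proof (induction n)
  case (Suc n)
  then show ?case using assms by (simp add: m_assoc inv_mult_cancel)
qed (use assms in simp)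

context amalgam
begin

lemma cls_pow: "u \<in> Words \<Longrightarrow> cls u [^]\<^bsub>A\<^esub> (n::nat) = cls (concat (replicate n u))"
proof (induction n)
  case (Suc n)
  have "concat (replicate n u) \<in> Words" using Suc.prems by (induction n) auto
  moreover have "concat (replicate n u) @ u = u @ concat (replicate n u)"
    by (induction n) auto
  ultimately show ?case using Suc by (simp add: mult_A)
qed (simp add: one_A)

lemma reduced_power:
  assumes u: "reduced u" "u \<noteq> []" and ends: "isl (last u) \<noteq> isl (hd u)"
  shows "reduced (concat (replicate n u))"
proof (induction n)
  case (Suc n)
  have "concat (replicate n u) = [] \<or> hd (concat (replicate n u)) = hd u"
    using u(2) by (cases n) auto
  then show ?case using Suc u ends by (auto simp: reduced_def alternating_def successively_append_iff)
qed (simp add: reduced_def alternating_def)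

lemma cyclically_reduced_infinite_order:
  assumes u: "reduced u" "u \<noteq> []" and ends: "isl (last u) \<noteq> isl (hd u)" and n: "0 < n"
  shows "cls u [^]\<^bsub>A\<^esub> (n::nat) \<noteq> \<one>\<^bsub>A\<^esub>"
  using reduced_nontrivial[OF reduced_power[OF u ends, of n]] u n
  by (simp add: cls_pow reduced_def)

lemma merge_letters:
  assumes "[x, y] \<in> Words" "isl x = isl y"
  obtains z where "([x, y], [z]) \<in> E"
proof (cases x)
  case (Inl g)
  with assms obtain g' where "y = Inl g'" by (cases y) auto
  with Inl assms that show thesis using amalgam_cong.mult_left[of g G g'] by auto
next
  case (Inr h)
  with assms obtain h' where "y = Inr h'" by (cases y) auto
  with Inr assms that show thesis using amalgam_cong.mult_right[of h H h'] by auto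
qed

lemma switch_letter:
  assumes "x \<in> amalgamated_letters"
  obtains x' where "([x], [x']) \<in> E" "isl x' = b"
proof -
  obtain c where c: "c \<in> C" "x = Inl c \<or> x = Inr (\<phi> c)"
    using assms by (auto simp: amalgamated_letters_def)
  have lr: "([Inl c], [Inr (\<phi> c)]) \<in> E" using c(1) by (rule amalgam_cong.amalgamate)
  then have "([Inl c], [Inl c]) \<in> E" "([Inr (\<phi> c)], [Inr (\<phi> c)]) \<in> E" "([Inr (\<phi> c)], [Inl c]) \<in> E"
    by (auto intro: amalgam_cong.sym amalgam_cong.refl dest: cong_Words)
  with lr c(2) that[of "Inl c"] that[of "Inr (\<phi> c)"] show thesis by (cases b) auto
qed

text \<open>
  A word of minimal length among those representing conjugates of \<open>a\<close> stays minimal when it is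
  rotated. So every cyclically adjacent pair of letters can be brought to the front, where two letters
  from the same factor could be merged, and an amalgamated letter could be moved to the other factor
  and then merged. If there are at least two letters, the word is therefore cyclically reduced and
  has infinite order.
\<close>

theorem torsion_conjugate_letter:
  assumes a: "a \<in> carrier A" and n: "0 < n" "a [^]\<^bsub>A\<^esub> (n::nat) = \<one>\<^bsub>A\<^esub>"
  obtains b l where "b \<in> carrier A" "[l] \<in> Words" "a = b \<otimes>\<^bsub>A\<^esub> cls [l] \<otimes>\<^bsub>A\<^esub> inv\<^bsub>A\<^esub> b"
proof -
  define rep where "rep u \<longleftrightarrow> u \<in> Words \<and>
    (\<exists>b\<in>carrier A. a = b \<otimes>\<^bsub>A\<^esub> cls u \<otimes>\<^bsub>A\<^esub> inv\<^bsub>A\<^esub> b)" for u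
  have rotate: "rep (q @ p)" if "rep (p @ q)" for p q
  proof -
    from that obtain b where b: "b \<in> carrier A" "p \<in> Words" "q \<in> Words"
      "a = b \<otimes>\<^bsub>A\<^esub> cls (p @ q) \<otimes>\<^bsub>A\<^esub> inv\<^bsub>A\<^esub> b" by (auto simp: rep_def)
    have "a = (b \<otimes>\<^bsub>A\<^esub> cls p) \<otimes>\<^bsub>A\<^esub> cls (q @ p) \<otimes>\<^bsub>A\<^esub> inv\<^bsub>A\<^esub> (b \<otimes>\<^bsub>A\<^esub> cls p)"
      using b by (simp add: mult_A[symmetric] cls_closed A.m_assoc A.inv_mult_group A.mult_inv_cancel)
    with b show ?thesis unfolding rep_def by (metis A.m_closed Words_simps(3) cls_closed)
  qed
  have cong: "rep v" if "rep u" "(u, v) \<in> E" for u v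
    using that cls_eqI[OF that(2)] cong_Words[OF that(2)] by (simp add: rep_def)
  obtain u0 where "u0 \<in> Words" "a = cls u0" using a by (auto simp: carrier_A)
  then have "rep u0" unfolding rep_def
    by (intro conjI bexI[of _ "\<one>\<^bsub>A\<^esub>"]) (auto simp: cls_closed)
  then obtain u where u: "rep u" and least: "\<And>v. rep v \<Longrightarrow> length u \<le> length v"
    using ex_has_least_nat[of rep u0 length] by blast
  have "length u < 2"
  proof (rule ccontr)
    assume "\<not> length u < 2"
    \<comment> \<open>Minimality, applied to the first two letters of any rotation of \<open>u\<close>.\<close>
    have front: "isl x \<noteq> isl y" "x \<notin> amalgamated_letters"
      if rep: "rep (x # y # z)" and len: "length (x # y # z) = length u" for x y z
    proof -
      have merge: "\<not> rep (x # y # z)" if same: "isl x = isl y" and len: "length (x # y # z) = length u" for x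
      proof
        assume rep: "rep (x # y # z)"
        then have W: "[x, y] \<in> Words" "z \<in> Words" by (auto simp: rep_def)
        obtain t where "([x, y], [t]) \<in> E" using merge_letters[OF W(1) same] .
        from cong_context[OF this, of "[]" z] W have "(x # y # z, t # z) \<in> E" by simp
        from least[OF cong[OF rep this]] len show False by simp
      qed
      from merge rep len show "isl x \<noteq> isl y" by blast
      show "x \<notin> amalgamated_letters"
      proof
        assume "x \<in> amalgamated_letters"
        then obtain x' where x': "([x], [x']) \<in> E" "isl x' = isl y" using switch_letter by blast
        have "y # z \<in> Words" using rep by (auto simp: rep_def)
        from cong_context[OF x'(1), of "[]" "y # z"] this
        have "(x # y # z, x' # y # z) \<in> E" by simp
        from cong[OF rep this] merge[OF x'(2)] len show False by simp
      qed
    qed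
    have "u \<noteq> []" using \<open>\<not> length u < 2\<close> by auto
    have letters: "set u \<inter> amalgamated_letters = {}"
    proof (rule ccontr)
      assume "\<not> ?thesis"
      then obtain p x q where x: "u = p @ x # q" "x \<in> amalgamated_letters"
        by (meson disjoint_iff split_list)
      then obtain y z where "q @ p = y # z" using \<open>\<not> length u < 2\<close> by (cases "q @ p") auto
      then have "rep (x # y # z)" "length (x # y # z) = length u"
        using rotate[of p "x # q"] u x(1) by (auto dest: arg_cong[where f = length])
      with front x(2) show False by blast
    qed
    have "alternating v" if "u = p @ v" for p v
      using that
    proof (induction v arbitrary: p)
      case (Cons x v)
      from Cons.IH[of "p @ [x]"] Cons.prems have IH: "alternating v" by simp
      show ?case
      proof (cases v)
        case (Cons y q)
        with Cons.prems have "rep (x # y # q @ p)" using rotate[of p "x # y # q"] u by simp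
        then have "isl x \<noteq> isl y" using front(1)[of x y "q @ p"] Cons.prems \<open>v = y # q\<close> by simp
        with IH Cons show ?thesis by (simp add: alternating_def)
      qed (simp add: alternating_def)
    qed (simp add: alternating_def)
    then have "reduced u" using u letters by (simp add: reduced_def rep_def)
    moreover have "isl (last u) \<noteq> isl (hd u)"
    proof -
      obtain y v where yv: "u = y # v" "v \<noteq> []" using \<open>\<not> length u < 2\<close> by (cases u) auto
      then have "u = (y # butlast v) @ [last v]" by simp
      then have "rep (last v # y # butlast v)" using rotate[of "y # butlast v" "[last v]"] u by simp
      then show ?thesis using front(1)[of "last v" y "butlast v"] yv by simp
    qed
    moreover have "cls u [^]\<^bsub>A\<^esub> n = \<one>\<^bsub>A\<^esub>"
    proof -
      obtain b where b: "b \<in> carrier A" "a = b \<otimes>\<^bsub>A\<^esub> cls u \<otimes>\<^bsub>A\<^esub> inv\<^bsub>A\<^esub> b"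
        using u by (auto simp: rep_def)
      have cl: "cls u \<in> carrier A" using u by (simp add: rep_def cls_closed)
      show ?thesis
        using n(2) b A.conj_nat_pow[OF b(1) cl] A.conj_eq_one_iff[OF b(1)] cl by simp
    qed
    ultimately show False
      using cyclically_reduced_infinite_order \<open>u \<noteq> []\<close> n(1) by blast
  qed
  then consider "u = []" | l where "u = [l]" by (cases u; cases "tl u") auto
  then obtain l where "rep [l]"
  proof cases
    case 1
    have "([], [Inl \<one>\<^bsub>G\<^esub>]) \<in> E" by (rule amalgam_cong.sym[OF amalgam_cong.one_left])
    with cong u 1 that show thesis by blast
  qed (use u in blast)
  then show thesis using that by (auto simp: rep_def)
qed

theorem torsion_2_power_amalgam:
  assumes G: "torsion_2_power G" and H: "torsion_2_power H"
  shows "torsion_2_power A"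
  unfolding torsion_2_power_def
proof (intro ballI allI impI)
  fix a and n :: nat assume a: "a \<in> carrier A" "0 < n" "a [^]\<^bsub>A\<^esub> n = \<one>\<^bsub>A\<^esub>"
  then obtain b l where b: "b \<in> carrier A" "[l] \<in> Words" "a = b \<otimes>\<^bsub>A\<^esub> cls [l] \<otimes>\<^bsub>A\<^esub> inv\<^bsub>A\<^esub> b"
    using torsion_conjugate_letter by metis
  have cl: "cls [l] \<in> carrier A" using b cls_closed by blast
  have pow: "a [^]\<^bsub>A\<^esub> m = \<one>\<^bsub>A\<^esub> \<longleftrightarrow> cls [l] [^]\<^bsub>A\<^esub> m = \<one>\<^bsub>A\<^esub>" for m :: nat
  proof -
    have "a [^]\<^bsub>A\<^esub> m = b \<otimes>\<^bsub>A\<^esub> cls [l] [^]\<^bsub>A\<^esub> m \<otimes>\<^bsub>A\<^esub> inv\<^bsub>A\<^esub> b"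
      using b cl A.conj_nat_pow by simp
    then show ?thesis using b cl A.conj_eq_one_iff by simp
  qed
  show "\<exists>k::nat. a [^]\<^bsub>A\<^esub> ((2::nat) ^ k) = \<one>\<^bsub>A\<^esub>"
  proof (cases l)
    case (Inl g)
    with b have g: "g \<in> carrier G" by simp
    have eq: "cls [l] [^]\<^bsub>A\<^esub> m = \<one>\<^bsub>A\<^esub> \<longleftrightarrow> g [^]\<^bsub>G\<^esub> m = \<one>\<^bsub>G\<^esub>" for m :: nat
      using inl.hom_nat_pow[OF g, of m] inl_inj g Inl
      by (metis G.nat_pow_closed G.one_closed inj_onD inl.hom_one)
    then show ?thesis using G g a unfolding pow torsion_2_power_def by blast
  next
    case (Inr h)
    with b have h: "h \<in> carrier H" by simp
    have eq: "cls [l] [^]\<^bsub>A\<^esub> m = \<one>\<^bsub>A\<^esub> \<longleftrightarrow> h [^]\<^bsub>H\<^esub> m = \<one>\<^bsub>H\<^esub>" for m :: nat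
      using inr.hom_nat_pow[OF h, of m] inr_inj h Inr
      by (metis H.nat_pow_closed H.one_closed inj_onD inr.hom_one)
    then show ?thesis using H h a unfolding pow torsion_2_power_def by blast
  qed
qed

lemma torsion_2_power_image:
  assumes "torsion_2_power G"
  shows "torsion_2_power (H\<lparr>carrier := \<phi> ` C\<rparr>)"
  unfolding torsion_2_power_def
proof (intro ballI allI impI)
  fix h and n :: nat
  assume *: "h \<in> carrier (H\<lparr>carrier := \<phi> ` C\<rparr>)" "0 < n"
    "h [^]\<^bsub>H\<lparr>carrier := \<phi> ` C\<rparr>\<^esub> n = \<one>\<^bsub>H\<lparr>carrier := \<phi> ` C\<rparr>\<^esub>"
  then obtain c where c: "c \<in> C" "h = \<phi> c" by auto
  have pow: "\<phi> (c [^]\<^bsub>G\<^esub> m) = h [^]\<^bsub>H\<^esub> m" for m :: nat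
    using phi.hom_nat_pow[of c m] c by (simp add: G.nat_pow_consistent[symmetric])
  have "c [^]\<^bsub>G\<^esub> n \<in> C" using B.nat_pow_closed[of c n] c by (simp add: G.nat_pow_consistent[symmetric])
  moreover have "\<phi> (c [^]\<^bsub>G\<^esub> n) = \<phi> \<one>\<^bsub>G\<^esub>"
    using * pow[of n] phi.hom_one by (simp add: H.nat_pow_consistent[symmetric])
  ultimately have "c [^]\<^bsub>G\<^esub> n = \<one>\<^bsub>G\<^esub>" using inj C subgroup.one_closed by (metis inj_onD)
  then obtain k :: nat where "c [^]\<^bsub>G\<^esub> ((2::nat) ^ k) = \<one>\<^bsub>G\<^esub>"
    using assms c C_closed *(2) unfolding torsion_2_power_def by blast
  then have "h [^]\<^bsub>H\<^esub> ((2::nat) ^ k) = \<one>\<^bsub>H\<^esub>" using pow[of "2 ^ k"] phi.hom_one by simp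
  then show "\<exists>k::nat. h [^]\<^bsub>H\<lparr>carrier := \<phi> ` C\<rparr>\<^esub> ((2::nat) ^ k) = \<one>\<^bsub>H\<lparr>carrier := \<phi> ` C\<rparr>\<^esub>"
    by (auto simp: H.nat_pow_consistent[symmetric])
qed

text \<open>
  The two-letter word \<open>g h\<close> is cyclically reduced.
\<close>

lemma infinite_carrier:
  assumes "g \<in> carrier G - C" "h \<in> carrier H - \<phi> ` C"
  shows "infinite (carrier A)"
proof
  assume fin: "finite (carrier A)"
  have red: "reduced [Inl g, Inr h]"
    using assms by (auto simp: reduced_def alternating_def amalgamated_letters_def)
  have "cls [Inl g, Inr h] [^]\<^bsub>A\<^esub> order A = \<one>\<^bsub>A\<^esub>"
    using red by (intro A.pow_order_eq_1 cls_closed) (simp add: reduced_def)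
  moreover have "0 < order A" using fin by (simp add: A.order_gt_0_iff_finite)
  ultimately show False using cyclically_reduced_infinite_order[OF red] by simp
qed

lemma finitely_generated_amalgam:
  assumes G: "finitely_generated G" and H: "finitely_generated H"
  shows "finitely_generated A"
proof -
  obtain S where S: "finite S" "S \<subseteq> carrier G" "generate G S = carrier G"
    using G by (auto simp: finitely_generated_def)
  obtain T where T: "finite T" "T \<subseteq> carrier H" "generate H T = carrier H"
    using H by (auto simp: finitely_generated_def)
  let ?U = "(\<lambda>g. cls [Inl g]) ` S \<union> (\<lambda>h. cls [Inr h]) ` T"
  have left: "cls [Inl g] \<in> generate A ?U" if "g \<in> carrier G" for g
    using that inl.generate_img[OF S(2)] S(3) A.mono_generate[of "(\<lambda>g. cls [Inl g]) ` S" ?U] by auto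
  have right: "cls [Inr h] \<in> generate A ?U" if "h \<in> carrier H" for h
    using that inr.generate_img[OF T(2)] T(3) A.mono_generate[of "(\<lambda>h. cls [Inr h]) ` T" ?U] by auto
  have "cls u \<in> generate A ?U" if "u \<in> Words" for u
    using that
  proof (induction u)
    case Nil
    then show ?case using generate.one[of A] by (simp add: one_A)
  next
    case (Cons l u)
    then have "cls [l] \<in> generate A ?U" using left right by (cases l) auto
    moreover have "cls u \<in> generate A ?U" using Cons by simp
    ultimately have "cls [l] \<otimes>\<^bsub>A\<^esub> cls u \<in> generate A ?U" by (rule generate.eng)
    then show ?case using Cons.prems by (simp add: mult_A)
  qed
  then have "carrier A \<subseteq> generate A ?U" by (auto simp: carrier_A)
  moreover have U: "?U \<subseteq> carrier A" using S T by (auto intro!: cls_closed)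
  ultimately have "generate A ?U = carrier A" using A.generate_incl by blast
  with U S T show ?thesis unfolding finitely_generated_def by (intro exI[of _ ?U]) auto
qed

theorem infinite_2_group_amalgam:
  assumes G: "finitely_generated G" "torsion_2_power G"
    and H: "finitely_generated H" "torsion_2_power H"
    and "C \<noteq> carrier G" "\<phi> ` C \<noteq> carrier H"
  shows "infinite_2_group A"
proof -
  obtain g where "g \<in> carrier G - C" using assms(5) C_closed by blast
  moreover obtain h where "h \<in> carrier H - \<phi> ` C" using assms(6) phi_closed by blast
  ultimately have "infinite (carrier A)" by (rule infinite_carrier)
  with finitely_generated_amalgam[OF G(1) H(1)] torsion_2_power_amalgam[OF G(2) H(2)] show ?thesis
    by (simp add: infinite_2_group_def A.torsion_2_power_iff_ord A.is_group)
qed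

end

section \<open>Flags of abstract polytopes\<close>

locale polytope =
  fixes d :: nat and P :: "'a ranked_poset"
  assumes polytope: "abstract_polytope d P"
begin

lemma po: "Partial_order (below P)"
  using polytope by (simp add: abstract_polytope_def)

lemma below_refl: "F \<in> faces P \<Longrightarrow> (F, F) \<in> below P"
  using po by (simp add: faces_def order_on_defs refl_on_def)

lemma below_trans: "(F, G) \<in> below P \<Longrightarrow> (G, H) \<in> below P \<Longrightarrow> (F, H) \<in> below P"
  using po by (meson order_on_defs(2,1) transD)

lemma below_antisym: "(F, G) \<in> below P \<Longrightarrow> (G, F) \<in> below P \<Longrightarrow> F = G"
  using po by (meson order_on_defs(2) antisymD)

lemma below_faces: "(F, G) \<in> below P \<Longrightarrow> F \<in> faces P \<and> G \<in> faces P"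
  by (auto simp: faces_def intro: FieldI1 FieldI2)

lemma rk_range: "F \<in> faces P \<Longrightarrow> rk P F \<in> {-1..int d}"
  using polytope by (auto simp: abstract_polytope_def)

lemma rk_strict: "(F, G) \<in> below P \<Longrightarrow> F \<noteq> G \<Longrightarrow> rk P F < rk P G"
  using polytope by (auto simp: abstract_polytope_def)

lemma rk_mono: "(F, G) \<in> below P \<Longrightarrow> rk P F \<le> rk P G"
  using rk_strict by (cases "F = G") (auto simp: less_imp_le)

lemma flag_bij: "\<Phi> \<in> flags P \<Longrightarrow> bij_betw (rk P) \<Phi> {-1..int d}"
  using polytope by (auto simp: abstract_polytope_def)

lemma bottom:
  assumes "F \<in> faces P" "G \<in> faces P" "rk P F = -1"
  shows "(F, G) \<in> below P"
proof -
  obtain L where "L \<in> faces P" "rk P L = -1" "\<forall>G\<in>faces P. (L, G) \<in> below P"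
    using polytope by (auto simp: abstract_polytope_def)
  with assms rk_strict show ?thesis by (metis less_irrefl)
qed

lemma top:
  assumes "F \<in> faces P" "G \<in> faces P" "rk P F = int d"
  shows "(G, F) \<in> below P"
proof -
  obtain L where "L \<in> faces P" "rk P L = int d" "\<forall>G\<in>faces P. (G, L) \<in> below P"
    using polytope by (auto simp: abstract_polytope_def)
  with assms rk_strict show ?thesis by (metis less_irrefl)
qed

lemma chain_comparable: "C \<in> Chains (below P) \<Longrightarrow> F \<in> C \<Longrightarrow> G \<in> C \<Longrightarrow> (F, G) \<in> below P \<or> (G, F) \<in> below P"
  by (simp add: Chains_def)

lemma chain_faces: "C \<in> Chains (below P) \<Longrightarrow> C \<subseteq> faces P"
  using chain_comparable below_faces by blast

lemma chain_inj: "C \<in> Chains (below P) \<Longrightarrow> inj_on (rk P) C"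
  by (rule inj_onI) (metis chain_comparable rk_strict less_irrefl)

lemma chain_less:
  assumes "C \<in> Chains (below P)" "F \<in> C" "G \<in> C" "rk P F \<le> rk P G"
  shows "(F, G) \<in> below P"
  using assms chain_comparable rk_strict by (metis linorder_not_less)

lemma flag_chain: "\<Phi> \<in> flags P \<Longrightarrow> \<Phi> \<in> Chains (below P)"
  by (simp add: flags_def)

lemma flag_faces: "\<Phi> \<in> flags P \<Longrightarrow> \<Phi> \<subseteq> faces P"
  using flag_chain chain_faces by blast

lemma flag_subset_eq: "\<Phi> \<in> flags P \<Longrightarrow> \<Psi> \<in> flags P \<Longrightarrow> \<Phi> \<subseteq> \<Psi> \<Longrightarrow> \<Phi> = \<Psi>"
  by (auto simp: flags_def)

text \<open>
  Since ranks are injective on chains, a chain that has a face of every rank cannot be enlarged.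
\<close>

lemma flagI:
  assumes chain: "C \<in> Chains (below P)" and full: "{-1..int d} \<subseteq> rk P ` C"
  shows "C \<in> flags P"
  unfolding flags_def
proof (intro CollectI conjI ballI impI chain)
  fix D assume D: "D \<in> Chains (below P)" "C \<subseteq> D"
  have "x \<in> C" if "x \<in> D" for x
  proof -
    have "rk P x \<in> rk P ` C" using that D chain_faces rk_range full by blast
    then obtain y where "y \<in> C" "rk P x = rk P y" by auto
    moreover from this have "x = y" using that D inj_onD[OF chain_inj[OF D(1)]] by blast
    ultimately show ?thesis by simp
  qed
  with D show "D = C" by blast
qed

lemma chain_finite: "C \<in> Chains (below P) \<Longrightarrow> finite C \<and> card C \<le> card {-1..int d}"
proof
  assume C: "C \<in> Chains (below P)"
  then have sub: "rk P ` C \<subseteq> {-1..int d}" using chain_faces rk_range by blast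
  with C show "finite C" using chain_inj finite_imageD finite_subset by blast
  show "card C \<le> card {-1..int d}"
    using card_mono[OF _ sub] card_image[OF chain_inj[OF C]] by simp
qed

text \<open>
  Chains have at most \<open>d + 2\<close> faces, so a largest chain above a given one exists and is a flag.
\<close>

lemma chain_in_flag:
  assumes "C \<in> Chains (below P)"
  obtains \<Phi> where "\<Phi> \<in> flags P" "C \<subseteq> \<Phi>"
proof -
  obtain D where D: "D \<in> Chains (below P)" "C \<subseteq> D"
    and max: "\<And>D'. D' \<in> Chains (below P) \<Longrightarrow> C \<subseteq> D' \<Longrightarrow> card D' \<le> card D"
    using ex_has_greatest_nat[of "\<lambda>D. D \<in> Chains (below P) \<and> C \<subseteq> D" C card "Suc (card {-1..int d})"]
      assms chain_finite by (metis le_imp_less_Suc order_refl)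
  have "D \<in> flags P"
    unfolding flags_def
  proof (intro CollectI conjI ballI impI D(1))
    fix D' assume "D' \<in> Chains (below P)" "D \<subseteq> D'"
    then show "D' = D" using max D chain_finite by (metis card_seteq order_trans)
  qed
  with D that show thesis by blast
qed

lemma face_in_flag:
  assumes "F \<in> faces P"
  obtains \<Phi> where "\<Phi> \<in> flags P" "F \<in> \<Phi>"
proof -
  have "{F} \<in> Chains (below P)" using assms by (simp add: Chains_def below_refl)
  then obtain \<Phi> where "\<Phi> \<in> flags P" "{F} \<subseteq> \<Phi>" by (rule chain_in_flag)
  with that show thesis by simp
qed

lemma flag_face:
  assumes "\<Phi> \<in> flags P" "j \<in> {-1..int d}"
  shows "flag_face P \<Phi> j \<in> \<Phi>" and rk_flag_face: "rk P (flag_face P \<Phi> j) = j"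
proof -
  have "\<exists>!F. F \<in> \<Phi> \<and> rk P F = j"
  proof -
    have "j \<in> rk P ` \<Phi>" using flag_bij[OF assms(1)] assms(2) by (simp add: bij_betw_def)
    then obtain F where "F \<in> \<Phi>" "rk P F = j" by blast
    then show ?thesis
      using chain_inj[OF flag_chain[OF assms(1)]] by (intro ex1I[of _ F]) (auto dest: inj_onD)
  qed
  from theI'[OF this] show "flag_face P \<Phi> j \<in> \<Phi>" "rk P (flag_face P \<Phi> j) = j"
    by (simp_all add: flag_face_def)
qed

lemma flag_rk_inj: "\<Phi> \<in> flags P \<Longrightarrow> F \<in> \<Phi> \<Longrightarrow> G \<in> \<Phi> \<Longrightarrow> rk P F = rk P G \<Longrightarrow> F = G"
  using chain_inj[OF flag_chain] by (blast dest: inj_onD)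

text \<open>
  The part of a flag below one of its faces is a flag of the corresponding section; this is the
  statement in terms of ranks.
\<close>

lemma flag_below_ranks:
  assumes "\<Phi> \<in> flags P" "F \<in> \<Phi>"
  shows "rk P ` flag_below P \<Phi> F = {-1..rk P F}"
proof (intro equalityI subsetI)
  fix r assume "r \<in> rk P ` flag_below P \<Phi> F"
  then show "r \<in> {-1..rk P F}"
    using rk_mono rk_range below_faces by (fastforce simp: flag_below_def)
next
  fix r assume r: "r \<in> {-1..rk P F}"
  have "rk P F \<le> int d" using assms flag_faces rk_range by fastforce
  with r have "r \<in> {-1..int d}" by simp
  note G = flag_face[OF assms(1) this]
  have "(flag_face P \<Phi> r, F) \<in> below P"
    using chain_less[OF flag_chain[OF assms(1)] G(1) assms(2)] G(2) r by simp
  with G show "r \<in> rk P ` flag_below P \<Phi> F"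
    by (intro image_eqI[of _ _ "flag_face P \<Phi> r"]) (simp_all add: flag_below_def)
qed

section \<open>Adjacent flags\<close>

lemma diamond:
  assumes \<Phi>: "\<Phi> \<in> flags P" and j: "j < d"
  shows "card {H \<in> faces P. rk P H = int j \<and> (flag_face P \<Phi> (int j - 1), H) \<in> below P \<and>
    (H, flag_face P \<Phi> (int j + 1)) \<in> below P} = 2"
proof -
  let ?F = "flag_face P \<Phi> (int j - 1)" and ?G = "flag_face P \<Phi> (int j + 1)"
  have F: "?F \<in> \<Phi>" "rk P ?F = int j - 1" and G: "?G \<in> \<Phi>" "rk P ?G = int j + 1"
    using flag_face[OF \<Phi>] j by auto
  have FG: "(?F, ?G) \<in> below P" using chain_less[OF flag_chain[OF \<Phi>]] F G by simp
  have gap: "rk P ?G = rk P ?F + 2" using F G by simp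
  have "diamond_condition P" using polytope by (simp add: abstract_polytope_def)
  then have "card {H \<in> faces P. rk P H = rk P ?F + 1 \<and> (?F, H) \<in> below P \<and> (H, ?G) \<in> below P} = 2"
    using FG gap unfolding diamond_condition_def by blast
  then show ?thesis using F(2) by simp
qed

text \<open>
  The condition that characterises \<open>flag_change P \<Phi> j\<close>, the flag \<open>\<Phi>\<^sup>j\<close>.
\<close>

definition j_adjacent :: "nat \<Rightarrow> 'a set \<Rightarrow> 'a set \<Rightarrow> bool" where
  "j_adjacent j \<Phi> \<Psi> \<longleftrightarrow> \<Psi> \<in> flags P \<and> \<Psi> \<noteq> \<Phi> \<and>
     {F \<in> \<Psi>. rk P F \<noteq> int j} = {F \<in> \<Phi>. rk P F \<noteq> int j}"

text \<open>
  The \<open>j\<close>-faces of \<open>\<Phi>\<close> and of the flags that are \<open>j\<close>-adjacent to it all lie between the faces of \<open>\<Phi>\<close>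
  of ranks \<open>j - 1\<close> and \<open>j + 1\<close>, where the diamond condition leaves room for only two.
\<close>

lemma j_adjacent_unique:
  assumes \<Phi>: "\<Phi> \<in> flags P" and j: "j < d" and "j_adjacent j \<Phi> \<Psi>" "j_adjacent j \<Phi> \<Psi>'"
  shows "\<Psi> = \<Psi>'"
proof -
  let ?F = "flag_face P \<Phi> (int j - 1)" and ?G = "flag_face P \<Phi> (int j + 1)"
  have F: "?F \<in> \<Phi>" "rk P ?F = int j - 1" and G: "?G \<in> \<Phi>" "rk P ?G = int j + 1"
    using flag_face[OF \<Phi>] j by auto
  let ?D = "{H \<in> faces P. rk P H = int j \<and> (?F, H) \<in> below P \<and> (H, ?G) \<in> below P}"
  have card: "card ?D = 2"
    by (rule diamond[OF \<Phi> j])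
  have D: "flag_face P \<Lambda> (int j) \<in> ?D" if "\<Lambda> \<in> flags P" "{F \<in> \<Lambda>. rk P F \<noteq> int j} = {F \<in> \<Phi>. rk P F \<noteq> int j}" for \<Lambda>
  proof -
    have H: "flag_face P \<Lambda> (int j) \<in> \<Lambda>" "rk P (flag_face P \<Lambda> (int j)) = int j"
      using flag_face[OF that(1)] j by auto
    have "{?F, ?G} \<subseteq> {F \<in> \<Phi>. rk P F \<noteq> int j}" using F G by simp
    then have "{?F, ?G} \<subseteq> \<Lambda>" unfolding that(2)[symmetric] by blast
    then show ?thesis
      using H F G chain_less[OF flag_chain[OF that(1)], of ?F "flag_face P \<Lambda> (int j)"]
        chain_less[OF flag_chain[OF that(1)], of "flag_face P \<Lambda> (int j)" ?G] flag_faces[OF that(1)] by auto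
  qed
  have eq: "\<Lambda> = \<Lambda>'" if "\<Lambda> \<in> flags P" "\<Lambda>' \<in> flags P"
    "{F \<in> \<Lambda>. rk P F \<noteq> int j} = {F \<in> \<Lambda>'. rk P F \<noteq> int j}"
    "flag_face P \<Lambda> (int j) = flag_face P \<Lambda>' (int j)" for \<Lambda> \<Lambda>'
  proof -
    have "\<Lambda> \<subseteq> \<Lambda>'"
    proof
      fix F assume "F \<in> \<Lambda>"
      show "F \<in> \<Lambda>'"
      proof (cases "rk P F = int j")
        case True
        have "F = flag_face P \<Lambda> (int j)"
          using flag_rk_inj[OF that(1) \<open>F \<in> \<Lambda>\<close>] flag_face[OF that(1), of "int j"] True j by simp
        then show ?thesis using that(4) flag_face[OF that(2), of "int j"] j by simp
      qed (use that(3) \<open>F \<in> \<Lambda>\<close> in blast)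
    qed
    then show ?thesis using flag_subset_eq that by blast
  qed
  have "flag_face P \<Psi> (int j) = flag_face P \<Psi>' (int j)"
  proof (rule ccontr)
    assume neq: "flag_face P \<Psi> (int j) \<noteq> flag_face P \<Psi>' (int j)"
    let ?S = "{flag_face P \<Phi> (int j), flag_face P \<Psi> (int j), flag_face P \<Psi>' (int j)}"
    have "?S \<subseteq> ?D" using D assms by (auto simp: j_adjacent_def)
    moreover have "flag_face P \<Phi> (int j) \<noteq> flag_face P \<Psi> (int j)" "flag_face P \<Phi> (int j) \<noteq> flag_face P \<Psi>' (int j)"
      using eq[OF \<Phi>] assms by (auto simp: j_adjacent_def)
    with neq have "card ?S = 3" by simp
    moreover have "finite ?D" using card by (metis (no_types, lifting) card.infinite zero_neq_numeral)
    ultimately show False using card card_mono[of ?D ?S] by simp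
  qed
  then show ?thesis using eq assms by (simp add: j_adjacent_def)
qed

text \<open>
  The second face provided by the diamond condition replaces the \<open>j\<close>-face of \<open>\<Phi>\<close>.
\<close>

lemma j_adjacent_exists:
  assumes \<Phi>: "\<Phi> \<in> flags P" and j: "j < d"
  shows "\<exists>\<Psi>. j_adjacent j \<Phi> \<Psi>"
proof -
  let ?F = "flag_face P \<Phi> (int j - 1)" and ?G = "flag_face P \<Phi> (int j + 1)" and ?M = "flag_face P \<Phi> (int j)"
  have F: "?F \<in> \<Phi>" "rk P ?F = int j - 1" and G: "?G \<in> \<Phi>" "rk P ?G = int j + 1"
    and M: "?M \<in> \<Phi>" "rk P ?M = int j"
    using flag_face[OF \<Phi>] j by auto
  let ?D = "{H \<in> faces P. rk P H = int j \<and> (?F, H) \<in> below P \<and> (H, ?G) \<in> below P}"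
  have card: "card ?D = 2"
    by (rule diamond[OF \<Phi> j])
  then have "\<not> ?D \<subseteq> {?M}" using card_mono[of "{?M}" ?D] by auto
  then obtain H where H: "H \<in> ?D" "H \<noteq> ?M" by blast
  then have rkH: "rk P H = int j" using F by simp
  have "H \<notin> \<Phi>" using H M rkH flag_rk_inj[OF \<Phi>] by metis
  let ?\<Psi> = "insert H (\<Phi> - {?M})"
  have comp: "(L, H) \<in> below P \<or> (H, L) \<in> below P" if L: "L \<in> \<Phi> - {?M}" for L
  proof -
    have "rk P L \<noteq> int j" using L M flag_rk_inj[OF \<Phi>] by (metis DiffD1 DiffD2 singletonI)
    then consider "rk P L \<le> rk P ?F" | "rk P ?G \<le> rk P L" using F G by linarith
    then show ?thesis
    proof cases
      case 1
      then have "(L, ?F) \<in> below P" using chain_less[OF flag_chain[OF \<Phi>]] L F by blast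
      then show ?thesis using H below_trans by blast
    next
      case 2
      then have "(?G, L) \<in> below P" using chain_less[OF flag_chain[OF \<Phi>]] L G by blast
      then show ?thesis using H below_trans by blast
    qed
  qed
  have chain: "?\<Psi> \<in> Chains (below P)"
    using comp chain_comparable[OF flag_chain[OF \<Phi>]] below_refl H unfolding Chains_def by blast
  have "r \<in> rk P ` ?\<Psi>" if "r \<in> {-1..int d}" for r
  proof (cases "r = int j")
    case True
    then show ?thesis using rkH by simp
  next
    case False
    then have "flag_face P \<Phi> r \<in> \<Phi> - {?M}" using flag_face[OF \<Phi> that] M by auto
    then show ?thesis using rk_flag_face[OF \<Phi> that] by (metis image_eqI insertI2)
  qed
  then have "?\<Psi> \<in> flags P" using flagI[OF chain] by blast
  moreover have "{F \<in> ?\<Psi>. rk P F \<noteq> int j} = {F \<in> \<Phi>. rk P F \<noteq> int j}" using rkH M by auto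
  ultimately show ?thesis using \<open>H \<notin> \<Phi>\<close> unfolding j_adjacent_def by blast
qed

lemma j_adjacent_flag_change:
  assumes "\<Phi> \<in> flags P" "j < d"
  shows "j_adjacent j \<Phi> (flag_change P \<Phi> j)"
proof -
  have "\<exists>!\<Psi>. j_adjacent j \<Phi> \<Psi>" using j_adjacent_exists j_adjacent_unique assms by blast
  from theI'[OF this] show ?thesis by (simp add: flag_change_def j_adjacent_def)
qed

lemma flag_change_eqI:
  assumes "\<Phi> \<in> flags P" "j < d" "j_adjacent j \<Phi> \<Psi>"
  shows "flag_change P \<Phi> j = \<Psi>"
  using j_adjacent_unique assms j_adjacent_flag_change by blast

lemma flag_change_flag: "\<Phi> \<in> flags P \<Longrightarrow> j < d \<Longrightarrow> flag_change P \<Phi> j \<in> flags P"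
  using j_adjacent_flag_change by (simp add: j_adjacent_def)

lemma flag_change_mem:
  assumes "\<Phi> \<in> flags P" "j < d" "rk P F \<noteq> int j"
  shows "F \<in> flag_change P \<Phi> j \<longleftrightarrow> F \<in> \<Phi>"
proof -
  have "F \<in> {F \<in> flag_change P \<Phi> j. rk P F \<noteq> int j} \<longleftrightarrow> F \<in> {F \<in> \<Phi>. rk P F \<noteq> int j}"
    using j_adjacent_flag_change[OF assms(1,2)] by (simp only: j_adjacent_def)
  then show ?thesis using assms(3) by simp
qed

lemma flag_change_new_face:
  assumes \<Phi>: "\<Phi> \<in> flags P" and j: "j < d" and F: "F \<in> \<Phi>" "rk P F = int j"
  shows "F \<notin> flag_change P \<Phi> j"
proof
  assume "F \<in> flag_change P \<Phi> j"
  then have "\<Phi> \<subseteq> flag_change P \<Phi> j"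
    using flag_change_mem[OF \<Phi> j] flag_rk_inj[OF \<Phi>] F by (metis subsetI)
  then have "\<Phi> = flag_change P \<Phi> j" using \<Phi> j flag_change_flag flag_subset_eq by blast
  then show False using j_adjacent_flag_change[OF \<Phi> j] by (simp add: j_adjacent_def)
qed

lemma adjacent_flag_change:
  assumes \<Phi>: "\<Phi> \<in> flags P" and j: "j < d"
  shows "adjacent \<Phi> (flag_change P \<Phi> j)"
proof -
  have *: "\<Lambda> - \<Lambda>' = {flag_face P \<Lambda> (int j)}"
    if \<Lambda>: "\<Lambda> \<in> flags P" "\<Lambda>' \<in> flags P" "\<Lambda> \<noteq> \<Lambda>'"
      "{F \<in> \<Lambda>. rk P F \<noteq> int j} = {F \<in> \<Lambda>'. rk P F \<noteq> int j}" for \<Lambda> \<Lambda>'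
  proof -
    have "F = flag_face P \<Lambda> (int j)" if "F \<in> \<Lambda> - \<Lambda>'" for F
      using that \<Lambda>(4) flag_face[OF \<Lambda>(1), of "int j"] j flag_rk_inj[OF \<Lambda>(1)] by auto
    moreover have "\<Lambda> - \<Lambda>' \<noteq> {}" using \<Lambda> flag_subset_eq by blast
    ultimately show ?thesis by blast
  qed
  let ?\<Psi> = "flag_change P \<Phi> j"
  have \<Psi>: "?\<Psi> \<in> flags P" "?\<Psi> \<noteq> \<Phi>" "{F \<in> ?\<Psi>. rk P F \<noteq> int j} = {F \<in> \<Phi>. rk P F \<noteq> int j}"
    using j_adjacent_flag_change[OF \<Phi> j] unfolding j_adjacent_def by blast+
  have "\<Phi> - ?\<Psi> = {flag_face P \<Phi> (int j)}"
    by (rule *[OF \<Phi> \<Psi>(1) \<Psi>(2)[symmetric] \<Psi>(3)[symmetric]])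
  moreover have "?\<Psi> - \<Phi> = {flag_face P ?\<Psi> (int j)}"
    by (rule *[OF \<Psi>(1) \<Phi> \<Psi>(2,3)])
  ultimately show ?thesis by (simp add: adjacent_def)
qed

text \<open>
  The faces exchanged between adjacent flags have the same rank, and this rank is neither \<open>-1\<close> nor
  \<open>d\<close> because the least and the greatest face are unique.
\<close>

lemma adjacentE:
  assumes \<Phi>: "\<Phi> \<in> flags P" and \<Psi>: "\<Psi> \<in> flags P" and adj: "adjacent \<Phi> \<Psi>"
  obtains j where "j < d" "\<Psi> = flag_change P \<Phi> j"
proof -
  obtain M N where M: "\<Phi> - \<Psi> = {M}" and N: "\<Psi> - \<Phi> = {N}"
    using adj by (auto simp: adjacent_def card_1_singleton_iff)
  have fM: "M \<in> faces P" "N \<in> faces P" using M N flag_faces \<Phi> \<Psi> by blast+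
  have rk: "rk P N = rk P M"
  proof (rule ccontr)
    assume neq: "rk P N \<noteq> rk P M"
    have "rk P M \<in> {-1..int d}" using fM rk_range by blast
    note F = flag_face[OF \<Psi> this]
    then have "flag_face P \<Psi> (rk P M) \<noteq> N" using neq by metis
    then have "flag_face P \<Psi> (rk P M) \<in> \<Phi>" using F N by blast
    then have "flag_face P \<Psi> (rk P M) = M" using flag_rk_inj[OF \<Phi>] F M by blast
    then show False using F M by blast
  qed
  have "M \<noteq> N" using M N by blast
  have "rk P M \<noteq> -1" using bottom fM \<open>M \<noteq> N\<close> rk_strict rk by (metis less_irrefl)
  moreover have "rk P M \<noteq> int d" using top fM \<open>M \<noteq> N\<close> rk_strict rk by (metis less_irrefl)
  moreover have "rk P M \<in> {-1..int d}" using fM rk_range by blast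
  ultimately have "0 \<le> rk P M" "rk P M < int d" by auto
  then obtain j where j: "rk P M = int j" "j < d" by (metis nonneg_int_cases of_nat_less_iff)
  have "F \<in> \<Psi> \<longleftrightarrow> F \<in> \<Phi>" if "rk P F \<noteq> int j" for F
  proof -
    have "F \<noteq> M" "F \<noteq> N" using that rk j(1) by auto
    then show ?thesis using M N by blast
  qed
  then have "{F \<in> \<Psi>. rk P F \<noteq> int j} = {F \<in> \<Phi>. rk P F \<noteq> int j}" by blast
  then have "j_adjacent j \<Phi> \<Psi>" using \<Psi> \<open>M \<noteq> N\<close> M unfolding j_adjacent_def by blast
  then have "\<Psi> = flag_change P \<Phi> j" using flag_change_eqI \<Phi> j by metis
  with j that show thesis by blast
qed

end

section \<open>Automorphism groups\<close>

lemma carrier_Aut: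
  "f \<in> carrier (Aut P) \<longleftrightarrow> f \<in> Bij (faces P) \<and>
     (\<forall>F\<in>faces P. \<forall>G\<in>faces P. (f F, f G) \<in> below P \<longleftrightarrow> (F, G) \<in> below P)"
  by (auto simp: Aut_def poset_isos_def Bij_def)

lemma mult_Aut: "f \<otimes>\<^bsub>Aut P\<^esub> g = compose (faces P) g f"
  by (simp add: Aut_def)

lemma one_Aut: "\<one>\<^bsub>Aut P\<^esub> = (\<lambda>F\<in>faces P. F)"
  by (simp add: Aut_def)

lemma Aut_closed: "f \<in> carrier (Aut P) \<Longrightarrow> F \<in> faces P \<Longrightarrow> f F \<in> faces P"
  using Bij_imp_funcset by (auto simp: carrier_Aut)

lemma Aut_bij: "f \<in> carrier (Aut P) \<Longrightarrow> bij_betw f (faces P) (faces P)"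
  by (simp add: carrier_Aut Bij_def)

lemma Aut_below:
  "f \<in> carrier (Aut P) \<Longrightarrow> F \<in> faces P \<Longrightarrow> G \<in> faces P \<Longrightarrow> (f F, f G) \<in> below P \<longleftrightarrow> (F, G) \<in> below P"
  by (simp add: carrier_Aut)

lemma Aut_ext:
  assumes "f \<in> carrier (Aut P)" "g \<in> carrier (Aut P)" "\<And>F. F \<in> faces P \<Longrightarrow> f F = g F"
  shows "f = g"
  using assms by (auto simp: carrier_Aut dest!: Bij_imp_extensional intro: extensionalityI)

lemma group_Aut: "group (Aut P)"
proof (rule groupI)
  fix f g assume f: "f \<in> carrier (Aut P)" and g: "g \<in> carrier (Aut P)"
  then show "f \<otimes>\<^bsub>Aut P\<^esub> g \<in> carrier (Aut P)"
    using Aut_closed[OF f] unfolding mult_Aut carrier_Aut by (simp add: compose_Bij compose_eq)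
next
  show "\<one>\<^bsub>Aut P\<^esub> \<in> carrier (Aut P)"
    by (simp add: carrier_Aut one_Aut id_Bij)
next
  fix f g h assume "f \<in> carrier (Aut P)" "g \<in> carrier (Aut P)" "h \<in> carrier (Aut P)"
  then show "f \<otimes>\<^bsub>Aut P\<^esub> g \<otimes>\<^bsub>Aut P\<^esub> h = f \<otimes>\<^bsub>Aut P\<^esub> (g \<otimes>\<^bsub>Aut P\<^esub> h)"
    by (auto simp: mult_Aut compose_def Aut_closed fun_eq_iff restrict_def)
next
  fix f assume f: "f \<in> carrier (Aut P)"
  then have ext: "f \<in> extensional (faces P)" by (simp add: carrier_Aut Bij_imp_extensional)
  then show "\<one>\<^bsub>Aut P\<^esub> \<otimes>\<^bsub>Aut P\<^esub> f = f"
    by (auto simp: mult_Aut one_Aut compose_def fun_eq_iff restrict_def extensional_def)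
  let ?g = "\<lambda>F\<in>faces P. inv_into (faces P) f F"
  have Bij: "f \<in> Bij (faces P)" using f by (simp add: carrier_Aut)
  have gB: "?g \<in> Bij (faces P)" using Bij by (rule restrict_inv_into_Bij)
  have g: "?g F \<in> faces P" "f (?g F) = F" if "F \<in> faces P" for F
    using that Bij_inv_into_mem[OF Bij that] bij_betw_inv_into_right[OF Aut_bij[OF f] that] by auto
  have "?g \<in> carrier (Aut P)"
    unfolding carrier_Aut
  proof (intro conjI ballI gB)
    fix F G assume "F \<in> faces P" "G \<in> faces P"
    then show "(?g F, ?g G) \<in> below P \<longleftrightarrow> (F, G) \<in> below P"
      using Aut_below[OF f, of "?g F" "?g G"] g by metis
  qed
  moreover have "?g \<otimes>\<^bsub>Aut P\<^esub> f = \<one>\<^bsub>Aut P\<^esub>"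
    using g by (auto simp: mult_Aut one_Aut compose_def fun_eq_iff restrict_def)
  ultimately show "\<exists>g\<in>carrier (Aut P). g \<otimes>\<^bsub>Aut P\<^esub> f = \<one>\<^bsub>Aut P\<^esub>" by blast
qed

lemma mult_Aut_image: "S \<subseteq> faces P \<Longrightarrow> (f \<otimes>\<^bsub>Aut P\<^esub> g) ` S = g ` f ` S"
  by (force simp: mult_Aut compose_eq)

lemma one_Aut_image: "S \<subseteq> faces P \<Longrightarrow> \<one>\<^bsub>Aut P\<^esub> ` S = S"
  by (force simp: one_Aut)

lemma stabiliser_subgroup:
  assumes "F \<in> faces P"
  shows "subgroup {f \<in> carrier (Aut P). f F = F} (Aut P)"
proof -
  interpret group "Aut P" by (rule group_Aut)
  show ?thesis
  proof (rule subgroupI)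
    have "\<one>\<^bsub>Aut P\<^esub> F = F" using assms by (simp add: one_Aut)
    then have "\<one>\<^bsub>Aut P\<^esub> \<in> {f \<in> carrier (Aut P). f F = F}" by simp
    then show "{f \<in> carrier (Aut P). f F = F} \<noteq> {}" by blast
  next
    fix f assume f: "f \<in> {f \<in> carrier (Aut P). f F = F}"
    then have "f \<otimes>\<^bsub>Aut P\<^esub> inv\<^bsub>Aut P\<^esub> f = \<one>\<^bsub>Aut P\<^esub>" by simp
    then have "(inv\<^bsub>Aut P\<^esub> f) (f F) = F"
      using assms by (metis compose_eq mult_Aut one_Aut restrict_apply')
    with f show "inv\<^bsub>Aut P\<^esub> f \<in> {f \<in> carrier (Aut P). f F = F}" by simp
  next
    fix f g assume fg: "f \<in> {f \<in> carrier (Aut P). f F = F}" "g \<in> {f \<in> carrier (Aut P). f F = F}"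
    then have "(f \<otimes>\<^bsub>Aut P\<^esub> g) F = F" using assms by (simp add: mult_Aut compose_eq)
    with fg show "f \<otimes>\<^bsub>Aut P\<^esub> g \<in> {f \<in> carrier (Aut P). f F = F}" by simp
  qed auto
qed

section \<open>Automorphisms act freely on flags\<close>

context polytope
begin

lemma aut_flag:
  assumes f: "f \<in> carrier (Aut P)" and \<Phi>: "\<Phi> \<in> flags P"
  shows "f ` \<Phi> \<in> flags P"
  unfolding flags_def
proof (intro CollectI conjI ballI impI)
  interpret group "Aut P" by (rule group_Aut)
  have image_chain: "g ` C \<in> Chains (below P)"
    if g: "g \<in> carrier (Aut P)" and C: "C \<in> Chains (below P)" for g C
  proof -
    have "(g F, g G) \<in> below P \<or> (g G, g F) \<in> below P" if "F \<in> C" "G \<in> C" for F G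
      using that Aut_below[OF g] chain_faces[OF C] chain_comparable[OF C] by blast
    then show ?thesis by (auto simp: Chains_def)
  qed
  show "f ` \<Phi> \<in> Chains (below P)" using image_chain f \<Phi> flag_chain by blast
  fix C assume C: "C \<in> Chains (below P)" "f ` \<Phi> \<subseteq> C"
  let ?g = "inv\<^bsub>Aut P\<^esub> f"
  have g: "?g \<in> carrier (Aut P)" using f by simp
  have "?g ` f ` \<Phi> = \<Phi>"
    using mult_Aut_image[OF flag_faces[OF \<Phi>], of f ?g] one_Aut_image[OF flag_faces[OF \<Phi>]] f by simp
  then have "\<Phi> \<subseteq> ?g ` C" using C by blast
  then have "?g ` C = \<Phi>" using \<Phi> image_chain[OF g C(1)] by (simp add: flags_def)
  then have "f ` \<Phi> = f ` ?g ` C" by simp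
  also have "\<dots> = C"
    using mult_Aut_image[OF chain_faces[OF C(1)], of ?g f] one_Aut_image[OF chain_faces[OF C(1)]] f by simp
  finally show "C = f ` \<Phi>" by simp
qed

lemma card_flag_below:
  assumes "\<Phi> \<in> flags P" "F \<in> \<Phi>"
  shows "int (card (flag_below P \<Phi> F)) = rk P F + 2"
proof -
  have "inj_on (rk P) (flag_below P \<Phi> F)"
    using flag_rk_inj[OF assms(1)] by (auto simp: inj_on_def flag_below_def)
  then have "card (flag_below P \<Phi> F) = card {-1..rk P F}"
    using flag_below_ranks[OF assms] card_image by metis
  moreover have "-1 \<le> rk P F" using assms flag_faces rk_range by fastforce
  ultimately show ?thesis by simp
qed

text \<open>
  Automorphisms are only required to preserve the order. They preserve ranks because the rank of a
  face is determined by the number of faces below it in a flag.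
\<close>

lemma aut_rk:
  assumes f: "f \<in> carrier (Aut P)" and F: "F \<in> faces P"
  shows "rk P (f F) = rk P F"
proof -
  obtain \<Phi> where \<Phi>: "\<Phi> \<in> flags P" "F \<in> \<Phi>" using F by (rule face_in_flag)
  have "flag_below P (f ` \<Phi>) (f F) = f ` flag_below P \<Phi> F"
    using Aut_below[OF f] flag_faces[OF \<Phi>(1)] F by (auto simp: flag_below_def)
  moreover have "inj_on f (flag_below P \<Phi> F)"
    using bij_betw_imp_inj_on[OF Aut_bij[OF f]] flag_faces[OF \<Phi>(1)]
    by (auto simp: flag_below_def intro: inj_on_subset)
  ultimately have "card (flag_below P (f ` \<Phi>) (f F)) = card (flag_below P \<Phi> F)"
    by (simp add: card_image)
  moreover have "f F \<in> f ` \<Phi>" using \<Phi> by blast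
  ultimately show ?thesis
    using card_flag_below[OF \<Phi>] card_flag_below[OF aut_flag[OF f \<Phi>(1)]] by fastforce
qed

lemma aut_fixes_face:
  assumes f: "f \<in> carrier (Aut P)" and \<Phi>: "\<Phi> \<in> flags P" and F: "F \<in> \<Phi>" "F \<in> f ` \<Phi>"
  shows "f F = F"
proof (rule flag_rk_inj[OF aut_flag[OF f \<Phi>]])
  show "f F \<in> f ` \<Phi>" using F by blast
  show "rk P (f F) = rk P F" using aut_rk[OF f] flag_faces[OF \<Phi>] F by blast
qed fact

lemma aut_flag_change:
  assumes f: "f \<in> carrier (Aut P)" and \<Phi>: "\<Phi> \<in> flags P" and j: "j < d"
  shows "f ` flag_change P \<Phi> j = flag_change P (f ` \<Phi>) j"
proof (rule flag_change_eqI[OF aut_flag[OF f \<Phi>] j, symmetric])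
  let ?\<Psi> = "flag_change P \<Phi> j"
  have \<Psi>: "?\<Psi> \<in> flags P" "?\<Psi> \<noteq> \<Phi>" "{F \<in> ?\<Psi>. rk P F \<noteq> int j} = {F \<in> \<Phi>. rk P F \<noteq> int j}"
    using j_adjacent_flag_change[OF \<Phi> j] unfolding j_adjacent_def by blast+
  have image: "{F \<in> f ` \<Lambda>. rk P F \<noteq> int j} = f ` {F \<in> \<Lambda>. rk P F \<noteq> int j}" if "\<Lambda> \<in> flags P" for \<Lambda>
    using aut_rk[OF f] flag_faces[OF that] by (auto simp: subset_iff)
  have "f ` ?\<Psi> \<noteq> f ` \<Phi>"
    using \<Psi>(2) inj_on_image_eq_iff[OF bij_betw_imp_inj_on[OF Aut_bij[OF f]]]
      flag_faces[OF \<Psi>(1)] flag_faces[OF \<Phi>] by blast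
  moreover have "{F \<in> f ` ?\<Psi>. rk P F \<noteq> int j} = {F \<in> f ` \<Phi>. rk P F \<noteq> int j}"
    unfolding image[OF \<Psi>(1)] image[OF \<Phi>] \<Psi>(3) ..
  ultimately show "j_adjacent j (f ` \<Phi>) (f ` ?\<Psi>)"
    using aut_flag[OF f \<Psi>(1)] unfolding j_adjacent_def by blast
qed

text \<open>
  A fixed flag passes its property on to adjacent flags, since automorphisms commute with
  \<open>\<Phi> \<mapsto> \<Phi>\<^sup>j\<close>, and hence to all flags by connectedness.
\<close>

lemma aut_fixing_flag:
  assumes f: "f \<in> carrier (Aut P)" and \<Phi>: "\<Phi> \<in> flags P" and fix\<Phi>: "f ` \<Phi> = \<Phi>"
  shows "f = \<one>\<^bsub>Aut P\<^esub>"
proof -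
  have all: "f ` \<Psi> = \<Psi>" if \<Psi>: "\<Psi> \<in> flags P" for \<Psi>
  proof -
    have "(\<Phi>, \<Psi>) \<in> {(\<Lambda>, \<Lambda>'). \<Lambda> \<in> flags P \<and> \<Lambda>' \<in> flags P \<and> adjacent \<Lambda> \<Lambda>' \<and>
                        \<Phi> \<inter> \<Psi> \<subseteq> \<Lambda> \<and> \<Phi> \<inter> \<Psi> \<subseteq> \<Lambda>'}\<^sup>*"
      using polytope \<Phi> \<Psi> unfolding abstract_polytope_def strongly_flag_connected_def by blast
    then show ?thesis
    proof (induction rule: rtrancl_induct)
      case (step \<Lambda> \<Lambda>')
      then have \<Lambda>: "\<Lambda> \<in> flags P" "\<Lambda>' \<in> flags P" "adjacent \<Lambda> \<Lambda>'" by auto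
      then obtain j where "j < d" "\<Lambda>' = flag_change P \<Lambda> j" using adjacentE by blast
      then show ?case using aut_flag_change[OF f \<Lambda>(1)] step.IH by simp
    qed (rule fix\<Phi>)
  qed
  show ?thesis
  proof (rule Aut_ext[OF f])
    interpret group "Aut P" by (rule group_Aut)
    show "\<one>\<^bsub>Aut P\<^esub> \<in> carrier (Aut P)" by simp
    fix F assume F: "F \<in> faces P"
    then obtain \<Psi> where \<Psi>: "\<Psi> \<in> flags P" "F \<in> \<Psi>" by (rule face_in_flag)
    then have "f F = F" using aut_fixes_face[OF f \<Psi>] all by blast
    then show "f F = \<one>\<^bsub>Aut P\<^esub> F" using F by (simp add: one_Aut)
  qed
qed

lemma aut_eqI:
  assumes f: "f \<in> carrier (Aut P)" and g: "g \<in> carrier (Aut P)"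
    and \<Phi>: "\<Phi> \<in> flags P" and eq: "f ` \<Phi> = g ` \<Phi>"
  shows "f = g"
proof -
  interpret group "Aut P" by (rule group_Aut)
  let ?h = "f \<otimes>\<^bsub>Aut P\<^esub> inv\<^bsub>Aut P\<^esub> g"
  have "?h ` \<Phi> = (g \<otimes>\<^bsub>Aut P\<^esub> inv\<^bsub>Aut P\<^esub> g) ` \<Phi>"
    by (simp only: mult_Aut_image[OF flag_faces[OF \<Phi>]] eq)
  then have "?h ` \<Phi> = \<Phi>" using g one_Aut_image[OF flag_faces[OF \<Phi>]] by simp
  then have "?h = \<one>\<^bsub>Aut P\<^esub>" using f g \<Phi> aut_fixing_flag by simp
  then show ?thesis using f g inv_equality by fastforce
qed

end

text \<open>
  In rank 0 the only faces are the least and the greatest one, so the automorphism group is trivial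
  and contains no subgroup of index two. This excludes chiral polytopes of rank below 2 with
  directly regular facets, for which the formal rank \<open>d - 1\<close> of the facets would be 0.
\<close>

lemma not_directly_regular_0: "\<not> directly_regular 0 P"
proof
  assume reg: "directly_regular 0 P"
  then interpret polytope 0 P
    by unfold_locales (simp add: directly_regular_def regular_def)
  obtain F where "F \<in> faces P" using polytope by (auto simp: abstract_polytope_def)
  then obtain \<Phi> where \<Phi>: "\<Phi> \<in> flags P" by (rule face_in_flag)
  have unique: "F = G" if "F \<in> faces P" "G \<in> faces P" "rk P F = rk P G" for F G
  proof -
    have "rk P F = -1 \<or> rk P F = int 0" using rk_range[OF that(1)] by auto
    then show ?thesis using that bottom top below_antisym by metis
  qed
  have "f = \<one>\<^bsub>Aut P\<^esub>" if f: "f \<in> carrier (Aut P)" for f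
  proof (rule aut_fixing_flag[OF f \<Phi>])
    have "f F = F" if "F \<in> \<Phi>" for F
      using that flag_faces[OF \<Phi>] unique[of "f F" F] aut_rk[OF f] Aut_closed[OF f] by blast
    then show "f ` \<Phi> = \<Phi>" by force
  qed
  then have "carrier (Aut P) = {\<one>\<^bsub>Aut P\<^esub>}"
    using group.is_monoid[OF group_Aut] monoid.one_closed by blast
  then have "card (rcosets\<^bsub>Aut P\<^esub> (rotation_subgroup 0 P \<Phi>)) = 1" by (simp add: RCOSETS_def)
  then show False using reg \<Phi> by (simp add: directly_regular_def)
qed

section \<open>Facets\<close>

context polytope
begin

lemma faces_lower_section: "F \<in> faces P \<Longrightarrow> faces (lower_section P F) = {H. (H, F) \<in> below P}"
  using below_refl below_faces
  by (auto simp: faces_def lower_section_def Field_def)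

lemma below_lower_section:
  "(G, H) \<in> below (lower_section P F) \<longleftrightarrow> (G, H) \<in> below P \<and> (G, F) \<in> below P \<and> (H, F) \<in> below P"
  by (auto simp: lower_section_def)

lemma rk_lower_section [simp]: "rk (lower_section P F) = rk P"
  by (simp add: lower_section_def)

lemma restrict_aut:
  assumes F: "F \<in> faces P" and f: "f \<in> carrier (Aut P)" "f F = F"
  shows "restrict f (faces (lower_section P F)) \<in> carrier (Aut (lower_section P F))"
proof -
  let ?S = "{H. (H, F) \<in> below P}"
  have S: "?S \<subseteq> faces P" using below_faces by blast
  have iff: "f H \<in> ?S \<longleftrightarrow> H \<in> ?S" if "H \<in> faces P" for H
    using Aut_below[OF f(1) that F] f(2) by simp
  have "f ` ?S = ?S"
  proof (intro equalityI subsetI)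
    fix H assume H: "H \<in> ?S"
    then obtain H' where "H' \<in> faces P" "H = f H'"
      using S bij_betw_imp_surj_on[OF Aut_bij[OF f(1)]] by blast
    with H iff show "H \<in> f ` ?S" by blast
  qed (use iff S in blast)
  moreover have "inj_on f ?S" using bij_betw_imp_inj_on[OF Aut_bij[OF f(1)]] S inj_on_subset by blast
  ultimately have "bij_betw (restrict f ?S) ?S ?S"
    using bij_betw_cong[of ?S f "restrict f ?S"] by (simp add: bij_betw_def)
  moreover have "(f G, f H) \<in> below P \<and> (f G, F) \<in> below P \<and> (f H, F) \<in> below P \<longleftrightarrow>
      (G, H) \<in> below P \<and> (G, F) \<in> below P \<and> (H, F) \<in> below P" if "G \<in> ?S" "H \<in> ?S" for G H
    using that S iff Aut_below[OF f(1), of G H] by blast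
  ultimately show ?thesis
    unfolding carrier_Aut faces_lower_section[OF F] below_lower_section by (simp add: Bij_def)
qed

lemma restrict_hom:
  assumes F: "F \<in> faces P"
  shows "(\<lambda>f. restrict f (faces (lower_section P F)))
    \<in> hom (Aut P\<lparr>carrier := {f \<in> carrier (Aut P). f F = F}\<rparr>) (Aut (lower_section P F))"
proof (rule homI)
  fix f g assume "f \<in> carrier (Aut P\<lparr>carrier := {f \<in> carrier (Aut P). f F = F}\<rparr>)"
    "g \<in> carrier (Aut P\<lparr>carrier := {f \<in> carrier (Aut P). f F = F}\<rparr>)"
  then have f: "f \<in> carrier (Aut P)" "f F = F" by auto
  have "H \<in> faces P \<and> (f H, F) \<in> below P" if "(H, F) \<in> below P" for H
    using that below_faces Aut_below[OF f(1), of H F] F f by auto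
  then show "restrict (f \<otimes>\<^bsub>Aut P\<lparr>carrier := {f \<in> carrier (Aut P). f F = F}\<rparr>\<^esub> g) (faces (lower_section P F)) =
    restrict f (faces (lower_section P F)) \<otimes>\<^bsub>Aut (lower_section P F)\<^esub> restrict g (faces (lower_section P F))"
    by (auto simp: mult_Aut faces_lower_section[OF F] compose_def fun_eq_iff restrict_def)
qed (use restrict_aut[OF F] in auto)

text \<open>
  A flag through the facet \<open>F\<close> consists of faces of \<open>F\<close> and the greatest face, so an automorphism that
  fixes \<open>F\<close> is determined by its restriction to \<open>F\<close>.
\<close>

lemma restrict_inj:
  assumes F: "F \<in> faces P" "rk P F = int d - 1"
  shows "inj_on (\<lambda>f. restrict f (faces (lower_section P F))) {f \<in> carrier (Aut P). f F = F}"
proof (rule inj_onI)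
  fix f g assume "f \<in> {f \<in> carrier (Aut P). f F = F}" "g \<in> {f \<in> carrier (Aut P). f F = F}"
    and eq: "restrict f (faces (lower_section P F)) = restrict g (faces (lower_section P F))"
  then have f: "f \<in> carrier (Aut P)" and g: "g \<in> carrier (Aut P)" by auto
  obtain \<Phi> where \<Phi>: "\<Phi> \<in> flags P" "F \<in> \<Phi>" using F(1) by (rule face_in_flag)
  have "f H = g H" if H: "H \<in> \<Phi>" for H
  proof (cases "(H, F) \<in> below P")
    case True
    then show ?thesis using fun_cong[OF eq, of H] by (simp add: faces_lower_section[OF F(1)])
  next
    case False
    then have "rk P F < rk P H" using chain_less[OF flag_chain[OF \<Phi>(1)] H \<Phi>(2)] by linarith
    moreover have HP: "H \<in> faces P" using H flag_faces[OF \<Phi>(1)] by blast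
    ultimately have "rk P H = int d" using F(2) rk_range[OF HP] by simp
    then have "rk P (f H) = int d" "rk P (g H) = int d" using aut_rk f g HP by auto
    then show ?thesis
      using top below_antisym Aut_closed[OF f HP] Aut_closed[OF g HP] by blast
  qed
  then have "f ` \<Phi> = g ` \<Phi>" by force
  then show "f = g" using aut_eqI f g \<Phi> by blast
qed

lemma flag_below_flag:
  assumes F: "F \<in> \<Phi>" and \<Phi>: "\<Phi> \<in> flags P"
    and sec: "polytope e (lower_section P F)" and e: "rk P F = int e"
  shows "flag_below P \<Phi> F \<in> flags (lower_section P F)"
proof (rule polytope.flagI[OF sec])
  show "flag_below P \<Phi> F \<in> Chains (below (lower_section P F))"
    using chain_comparable[OF flag_chain[OF \<Phi>]]
    by (auto simp: Chains_def below_lower_section flag_below_def)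
  show "{-1..int e} \<subseteq> rk (lower_section P F) ` flag_below P \<Phi> F"
    using flag_below_ranks[OF \<Phi> F] e by simp
qed

text \<open>
  Passing to the section below a face \<open>F\<close> of the flag commutes with changing faces of rank less than
  that of \<open>F\<close>.
\<close>

lemma flag_change_lower_section:
  assumes F: "F \<in> \<Phi>" and \<Phi>: "\<Phi> \<in> flags P"
    and sec: "polytope e (lower_section P F)" and e: "rk P F = int e" and i: "i < e"
  shows "flag_change (lower_section P F) (flag_below P \<Phi> F) i = flag_below P (flag_change P \<Phi> i) F"
proof -
  interpret S: polytope e "lower_section P F" by (rule sec)
  have "rk P F \<le> int d" using F flag_faces[OF \<Phi>] rk_range by fastforce
  then have id: "i < d" using e i by simp
  let ?\<Psi> = "flag_change P \<Phi> i"
  have \<Psi>: "?\<Psi> \<in> flags P" using flag_change_flag[OF \<Phi> id] .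
  have F\<Psi>: "F \<in> ?\<Psi>" using flag_change_mem[OF \<Phi> id] F e i by simp
  have "flag_below P ?\<Psi> F \<noteq> flag_below P \<Phi> F"
  proof
    assume eq: "flag_below P ?\<Psi> F = flag_below P \<Phi> F"
    let ?G = "flag_face P \<Phi> (int i)"
    have G: "?G \<in> \<Phi>" "rk P ?G = int i" using flag_face[OF \<Phi>, of "int i"] id by auto
    then have "(?G, F) \<in> below P" using chain_less[OF flag_chain[OF \<Phi>] G(1) F] e i by simp
    then have "?G \<in> flag_below P ?\<Psi> F" using G eq by (simp add: flag_below_def)
    then show False using flag_change_new_face[OF \<Phi> id G] by (simp add: flag_below_def)
  qed
  moreover have "{H \<in> flag_below P ?\<Psi> F. rk P H \<noteq> int i} = {H \<in> flag_below P \<Phi> F. rk P H \<noteq> int i}"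
    using flag_change_mem[OF \<Phi> id] by (auto simp: flag_below_def)
  ultimately have "S.j_adjacent i (flag_below P \<Phi> F) (flag_below P ?\<Psi> F)"
    using flag_below_flag[OF F\<Psi> \<Psi> sec e] unfolding S.j_adjacent_def rk_lower_section by blast
  then show ?thesis using S.flag_change_eqI flag_below_flag[OF F \<Phi> sec e] i by blast
qed

section \<open>Reflections and rotations\<close>

lemma reflection:
  assumes reg: "regular d P" and \<Phi>: "\<Phi> \<in> flags P" and i: "i < d"
  shows "reflection P \<Phi> i \<in> carrier (Aut P)" "reflection P \<Phi> i ` \<Phi> = flag_change P \<Phi> i"
proof -
  have "\<exists>!f. f \<in> carrier (Aut P) \<and> f ` \<Phi> = flag_change P \<Phi> i"
    using reg \<Phi> flag_change_flag[OF \<Phi> i] aut_eqI[OF _ _ \<Phi>] unfolding regular_def by metis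
  from theI'[OF this] show "reflection P \<Phi> i \<in> carrier (Aut P)" "reflection P \<Phi> i ` \<Phi> = flag_change P \<Phi> i"
    unfolding reflection_def by blast+
qed

text \<open>
  Automorphisms act on the right and commute with \<open>\<Phi> \<mapsto> \<Phi>\<^sup>j\<close>, so \<open>\<rho>\<^sub>i\<^sub>-\<^sub>1 \<rho>\<^sub>i\<close> maps \<open>\<Phi>\<close> to
  \<open>(\<Phi>\<^sup>i\<^sup>-\<^sup>1) \<rho>\<^sub>i = (\<Phi> \<rho>\<^sub>i)\<^sup>i\<^sup>-\<^sup>1 = (\<Phi>\<^sup>i)\<^sup>i\<^sup>-\<^sup>1\<close>.
\<close>

lemma reflection_mult:
  assumes reg: "regular d P" and \<Phi>: "\<Phi> \<in> flags P" and i: "1 \<le> i" "i < d"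
  shows "(reflection P \<Phi> (i - 1) \<otimes>\<^bsub>Aut P\<^esub> reflection P \<Phi> i) ` \<Phi> = flag_change P (flag_change P \<Phi> i) (i - 1)"
proof -
  have i1: "i - 1 < d" using i by simp
  show ?thesis
    using reflection[OF reg \<Phi> i(2)] reflection[OF reg \<Phi> i1] aut_flag_change[OF _ \<Phi> i1]
    by (simp add: mult_Aut_image[OF flag_faces[OF \<Phi>]])
qed

end

section \<open>Chiral polytopes\<close>

lemma flag_orbit_self:
  assumes "\<Phi> \<subseteq> faces P"
  shows "\<Phi> \<in> flag_orbit P \<Phi>"
proof -
  have "\<one>\<^bsub>Aut P\<^esub> \<in> carrier (Aut P)" using group.is_monoid[OF group_Aut] monoid.one_closed by blast
  then show ?thesis
    using one_Aut_image[OF assms] by (force simp: flag_orbit_def)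
qed

locale chiral_polytope = polytope +
  assumes chiral: "chiral d P"
begin

text \<open>
  There are two flag orbits and each change of a face switches between them, so two changes lead
  back to the orbit of \<open>\<Phi>\<close>.
\<close>

lemma two_step_aut:
  assumes \<Phi>: "\<Phi> \<in> flags P" and i: "i < d" "j < d"
  obtains f where "f \<in> carrier (Aut P)" "f ` \<Phi> = flag_change P (flag_change P \<Phi> i) j"
proof -
  let ?\<Psi> = "flag_change P \<Phi> i"
  let ?\<Omega> = "flag_change P ?\<Psi> j"
  have \<Psi>: "?\<Psi> \<in> flags P" using flag_change_flag[OF \<Phi> i(1)] .
  have \<Omega>: "?\<Omega> \<in> flags P" using flag_change_flag[OF \<Psi> i(2)] .
  have "flag_orbit P \<Phi> \<noteq> flag_orbit P ?\<Psi>" "flag_orbit P ?\<Psi> \<noteq> flag_orbit P ?\<Omega>"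
    using chiral \<Phi> \<Psi> \<Omega> adjacent_flag_change[OF \<Phi> i(1)] adjacent_flag_change[OF \<Psi> i(2)]
    unfolding chiral_def by blast+
  moreover obtain a b where ab: "flag_orbit P ` flags P = {a, b}"
    using chiral by (auto simp: chiral_def card_2_iff)
  have "flag_orbit P \<Phi> \<in> {a, b}" "flag_orbit P ?\<Psi> \<in> {a, b}" "flag_orbit P ?\<Omega> \<in> {a, b}"
    unfolding ab[symmetric] using \<Phi> \<Psi> \<Omega> by simp_all
  ultimately have "flag_orbit P \<Phi> = flag_orbit P ?\<Omega>" by (metis insertE singletonD)
  then have "?\<Omega> \<in> flag_orbit P \<Phi>" using flag_orbit_self[OF flag_faces[OF \<Omega>]] by simp
  then show thesis using that by (auto simp: flag_orbit_def)
qed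

lemma chiral_rotation:
  assumes \<Phi>: "\<Phi> \<in> flags P" and i: "1 \<le> i" "i < d"
  shows "chiral_rotation P \<Phi> i \<in> carrier (Aut P)"
    "chiral_rotation P \<Phi> i ` \<Phi> = flag_change P (flag_change P \<Phi> i) (i - 1)"
proof -
  have i1: "i - 1 < d" using i by simp
  have "\<exists>!f. f \<in> carrier (Aut P) \<and> f ` \<Phi> = flag_change P (flag_change P \<Phi> i) (i - 1)"
    using two_step_aut[OF \<Phi> i(2) i1] aut_eqI[OF _ _ \<Phi>] by metis
  from theI'[OF this] show "chiral_rotation P \<Phi> i \<in> carrier (Aut P)"
    "chiral_rotation P \<Phi> i ` \<Phi> = flag_change P (flag_change P \<Phi> i) (i - 1)"
    unfolding chiral_rotation_def by blast+
qed

end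

locale oriented_chiral_polytope = chiral_polytope +
  fixes \<Phi> :: "'a set"
  assumes base: "\<Phi> \<in> flags P"
    and facets: "has_directly_regular_facets d P"
begin

abbreviation "facet \<equiv> flag_face P \<Phi> (int d - 1)"
abbreviation "facet_section \<equiv> lower_section P facet"
abbreviation "facet_flag \<equiv> flag_below P \<Phi> facet"
abbreviation "facet_stabiliser \<equiv> {f \<in> carrier (Aut P). f facet = facet}"
abbreviation "facet_rotations \<equiv> generate (Aut P) {chiral_rotation P \<Phi> i | i. 1 \<le> i \<and> i < d - 1}"
abbreviation "facet_restrict \<equiv> \<lambda>f. restrict f (faces facet_section)"

lemma facet: "facet \<in> \<Phi>" "facet \<in> faces P" and rk_facet: "rk P facet = int d - 1"
  using flag_face[OF base, of "int d - 1"] flag_faces[OF base] by auto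

lemma directly_regular_facet: "directly_regular (d - 1) facet_section"
  using facets facet rk_facet by (simp add: has_directly_regular_facets_def)

lemma d_ge_2: "2 \<le> d"
proof (rule ccontr)
  assume "\<not> 2 \<le> d"
  then have "d - 1 = 0" by simp
  then show False using directly_regular_facet not_directly_regular_0 by metis
qed

lemma rk_facet_nat: "rk P facet = int (d - 1)"
  using rk_facet d_ge_2 by simp

lemma regular_facet: "regular (d - 1) facet_section"
  using directly_regular_facet by (simp add: directly_regular_def)

sublocale S: polytope "d - 1" facet_section
  using regular_facet by unfold_locales (simp add: regular_def)

lemma facet_flag: "facet_flag \<in> flags facet_section"
  by (rule flag_below_flag[OF facet(1) base S.polytope_axioms rk_facet_nat])

text \<open>
  For \<open>i < d - 1\<close> the rotation \<open>\<sigma>\<^sub>i\<close> changes only faces of \<open>\<Phi>\<close> of ranks \<open>i\<close> and \<open>i - 1\<close>, hence fixes the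
  base facet. On the facet, its restriction and \<open>\<rho>\<^sub>i\<^sub>-\<^sub>1 \<rho>\<^sub>i\<close> have the same effect on the base flag, so
  they coincide.
\<close>

lemma chiral_rotation_facet:
  assumes i: "1 \<le> i" "i < d - 1"
  shows "chiral_rotation P \<Phi> i \<in> facet_stabiliser"
    and "facet_restrict (chiral_rotation P \<Phi> i) =
      reflection facet_section facet_flag (i - 1) \<otimes>\<^bsub>Aut facet_section\<^esub> reflection facet_section facet_flag i"
proof -
  let ?s = "chiral_rotation P \<Phi> i"
  have id: "i < d" "i - 1 < d" "i - 1 < d - 1" using i by auto
  note s = chiral_rotation[OF base i(1) id(1)]
  let ?\<Psi> = "flag_change P \<Phi> i"
  have \<Psi>: "?\<Psi> \<in> flags P" using flag_change_flag[OF base id(1)] .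
  have F\<Psi>: "facet \<in> ?\<Psi>" using flag_change_mem[OF base id(1)] facet rk_facet i by simp
  then have "facet \<in> flag_change P ?\<Psi> (i - 1)" using flag_change_mem[OF \<Psi> id(2)] rk_facet i by simp
  then have fix_facet: "?s facet = facet" using aut_fixes_face[OF s(1) base facet(1)] s(2) by simp
  then show stab: "?s \<in> facet_stabiliser" using s(1) by simp
  show "facet_restrict ?s = reflection facet_section facet_flag (i - 1) \<otimes>\<^bsub>Aut facet_section\<^esub> reflection facet_section facet_flag i"
  proof (rule S.aut_eqI[OF _ _ facet_flag])
    interpret AS: group "Aut facet_section" by (rule group_Aut)
    show "facet_restrict ?s \<in> carrier (Aut facet_section)"
      using restrict_aut[OF facet(2)] s(1) fix_facet by simp
    show "reflection facet_section facet_flag (i - 1) \<otimes>\<^bsub>Aut facet_section\<^esub> reflection facet_section facet_flag i \<in> carrier (Aut facet_section)"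
      using S.reflection(1)[OF regular_facet facet_flag] i(2) id(3) by simp
    have "facet_restrict ?s ` facet_flag = ?s ` facet_flag"
      using faces_lower_section[OF facet(2)] by (force simp: flag_below_def)
    also have "\<dots> = flag_below P (?s ` \<Phi>) facet"
      using Aut_below[OF s(1) _ facet(2)] fix_facet flag_faces[OF base] by (force simp: flag_below_def)
    also have "\<dots> = flag_change facet_section (flag_below P ?\<Psi> facet) (i - 1)"
      unfolding s(2) by (rule flag_change_lower_section[OF F\<Psi> \<Psi> S.polytope_axioms rk_facet_nat id(3), symmetric])
    also have "flag_below P ?\<Psi> facet = flag_change facet_section facet_flag i"
      by (rule flag_change_lower_section[OF facet(1) base S.polytope_axioms rk_facet_nat i(2), symmetric])
    also have "flag_change facet_section (flag_change facet_section facet_flag i) (i - 1) =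
      (reflection facet_section facet_flag (i - 1) \<otimes>\<^bsub>Aut facet_section\<^esub> reflection facet_section facet_flag i) ` facet_flag"
      using S.reflection_mult[OF regular_facet facet_flag i] by simp
    finally show "facet_restrict ?s ` facet_flag = \<dots>" .
  qed
qed

lemma rotations_subset_stabiliser: "{chiral_rotation P \<Phi> i | i. 1 \<le> i \<and> i < d - 1} \<subseteq> facet_stabiliser"
  using chiral_rotation_facet(1) by auto

lemma facet_rotations_stabiliser: "facet_rotations \<subseteq> facet_stabiliser"
  by (rule group.generate_subgroup_incl[OF group_Aut rotations_subset_stabiliser stabiliser_subgroup[OF facet(2)]])

lemma facet_rotations_generate:
  "facet_restrict ` facet_rotations =
    generate (Aut facet_section) (facet_restrict ` {chiral_rotation P \<Phi> i | i. 1 \<le> i \<and> i < d - 1})"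
proof -
  let ?T = "Aut P\<lparr>carrier := facet_stabiliser\<rparr>"
  let ?R = "{chiral_rotation P \<Phi> i | i. 1 \<le> i \<and> i < d - 1}"
  interpret AP: group "Aut P" by (rule group_Aut)
  interpret AS: group "Aut facet_section" by (rule group_Aut)
  interpret T: group ?T using stabiliser_subgroup[OF facet(2)] by (rule AP.subgroup_imp_group)
  interpret res: group_hom ?T "Aut facet_section" facet_restrict
    using restrict_hom[OF facet(2)] by unfold_locales
  have "generate ?T ?R = facet_rotations"
    by (rule AP.generate_consistent[OF rotations_subset_stabiliser stabiliser_subgroup[OF facet(2)]])
  then show ?thesis
    using res.generate_img[of ?R] rotations_subset_stabiliser by simp
qed

lemma facet_rotations_image: "facet_restrict ` facet_rotations = rotation_subgroup (d - 1) facet_section facet_flag"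
proof -
  have "facet_restrict ` {chiral_rotation P \<Phi> i | i. 1 \<le> i \<and> i < d - 1} =
    {reflection facet_section facet_flag (i - 1) \<otimes>\<^bsub>Aut facet_section\<^esub>
      reflection facet_section facet_flag i | i. 1 \<le> i \<and> i < d - 1}"
    unfolding setcompr_eq_image image_image
    by (rule image_cong) (use chiral_rotation_facet(2) in auto)
  then show ?thesis
    by (simp only: facet_rotations_generate rotation_subgroup_def)
qed

lemma index_facet_rotations: "card (rcosets\<^bsub>Aut facet_section\<^esub> (facet_restrict ` facet_rotations)) = 2"
  unfolding facet_rotations_image
  using directly_regular_facet facet_flag by (simp only: directly_regular_def)

text \<open>
  The automorphism that maps \<open>\<Phi>\<close> to \<open>(\<Phi>\<^sup>d\<^sup>-\<^sup>1)\<^sup>d\<^sup>-\<^sup>2\<close> moves the base facet, because the facet of the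
  image flag is that of \<open>\<Phi>\<^sup>d\<^sup>-\<^sup>1\<close>.
\<close>

lemma stabiliser_proper: "facet_stabiliser \<noteq> carrier (Aut P)"
proof
  assume all: "facet_stabiliser = carrier (Aut P)"
  have j: "d - 1 < d" "d - 2 < d" using d_ge_2 by auto
  obtain f where f: "f \<in> carrier (Aut P)" "f ` \<Phi> = flag_change P (flag_change P \<Phi> (d - 1)) (d - 2)"
    using two_step_aut[OF base j] .
  have \<Psi>: "flag_change P \<Phi> (d - 1) \<in> flags P" using flag_change_flag[OF base j(1)] .
  have "facet \<in> f ` \<Phi>" using all f(1) facet(1) by force
  moreover have "rk P facet \<noteq> int (d - 2)" using rk_facet d_ge_2 by simp
  ultimately have "facet \<in> flag_change P \<Phi> (d - 1)" using f(2) flag_change_mem[OF \<Psi> j(2)] by simp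
  then show False using flag_change_new_face[OF base j(1) facet(1) rk_facet_nat] by simp
qed

end

section \<open>The free extension\<close>

theorem theorem7p2:
  fixes K :: "'a ranked_poset" and \<Phi> :: "'a set"
    and P :: "'b ranked_poset" and \<Psi> :: "'b set" and d :: nat
  assumes "oriented_chiral d K \<Phi>"
    and "has_directly_regular_facets d K"
    and "finite_2_group (Aut K) \<or> infinite_2_group (Aut K)"
    and "free_extension d K \<Phi> P \<Psi>"
  shows "oriented_chiral (d + 1) P \<Psi> \<and> infinite_2_group (Aut P)"
proof
  show "oriented_chiral (d + 1) P \<Psi>"
    using assms(4) by (simp add: free_extension_def chiral_extension_def)
  interpret K: oriented_chiral_polytope d K \<Phi>
    using assms(1,2) by unfold_locales (auto simp: oriented_chiral_def chiral_def)
  let ?H = "Aut K.facet_section"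
  let ?R = "{chiral_rotation K \<Phi> i | i. 1 \<le> i \<and> i < d - 1}"
  interpret AK: group "Aut K" by (rule group_Aut)
  interpret H: group ?H by (rule group_Aut)
  have R: "?R \<subseteq> carrier (Aut K)" using K.rotations_subset_stabiliser by blast
  interpret am: amalgam "Aut K" ?H K.facet_rotations K.facet_restrict
  proof (intro amalgam.intro amalgam_axioms.intro AK.is_group H.is_group)
    show "subgroup K.facet_rotations (Aut K)" using R by (rule AK.generate_is_subgroup)
    show "K.facet_restrict \<in> hom (Aut K\<lparr>carrier := K.facet_rotations\<rparr>) ?H"
      using K.restrict_hom[OF K.facet(2)] K.facet_rotations_stabiliser by (auto simp: hom_def)
    show "inj_on K.facet_restrict K.facet_rotations"
      using K.restrict_inj[OF K.facet(2) K.rk_facet] K.facet_rotations_stabiliser by (rule inj_on_subset)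
  qed
  have D: "subgroup (K.facet_restrict ` K.facet_rotations) ?H"
    using am.phi.img_is_subgroup by simp
  have gen: "finitely_generated (Aut K)" and tor: "torsion_2_power (Aut K)"
    using assms(3) finitely_generated_if_2_group torsion_2_power_if_2_group by blast+
  have gen_D: "K.facet_restrict ` K.facet_rotations = generate ?H (K.facet_restrict ` ?R)"
    using K.facet_rotations_generate .
  have "finitely_generated ?H"
  proof (rule H.finitely_generated_index_two)
    show "card (rcosets\<^bsub>?H\<^esub> (generate ?H (K.facet_restrict ` ?R))) = 2"
      using K.index_facet_rotations unfolding gen_D .
    show "finite (K.facet_restrict ` ?R)" by simp
    show "K.facet_restrict ` ?R \<subseteq> carrier ?H"
      using K.restrict_aut[OF K.facet(2)] K.rotations_subset_stabiliser by blast
  qed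
  moreover have "torsion_2_power ?H"
    using H.torsion_2_power_index_two[OF D K.index_facet_rotations] am.torsion_2_power_image tor by blast
  moreover have "K.facet_rotations \<noteq> carrier (Aut K)"
    using K.facet_rotations_stabiliser K.stabiliser_proper by blast
  moreover have "K.facet_restrict ` K.facet_rotations \<noteq> carrier ?H"
    using H.index_two_proper[OF D K.index_facet_rotations] by metis
  ultimately have "infinite_2_group am.A"
    using am.infinite_2_group_amalgam gen tor by blast
  moreover have "am.A = free_extension_group d K \<Phi>"
    by (simp only: free_extension_group_def Let_def)
  ultimately show "infinite_2_group (Aut P)"
    using infinite_2_group_iso[OF group_Aut[of P] am.A.is_group] assms(4) by (simp add: free_extension_def)
qed

end
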